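(* Consider the packet-skipping queueing model described in the context, with arrival rate $\lambda>0$, service rate $\mu>0$, relative deadline $d>0$ and threshold $\theta\in[0,d]$. Then the goodput $\gamma(\theta)$ is $$\gamma(\theta)=\lambda\,\mathbb{P}(L=0)\,(1-e^{-\mu d})+\lambda\,(1-\mathbb{P}(L=0))\Big[\frac{\mu}{\lambda+\mu}\big(1-e^{-(\lambda+\mu)(d-\theta)}\big)-\frac{\mu e^{-\mu d}}{\lambda}\big(1-e^{-\lambda(d-\theta)}\big)\Big],$$ where $\mathbb{P}(L=0)$, the probability that an arbitrary arriving packet finds the system empty (equivalently, the long-run fraction of time the system is empty), equals $$\mathbb{P}(L=0)=1-\frac{\lambda^2+\lambda\mu}{\mu^2+\lambda\mu e^{-(\lambda+\mu)(d-\theta)}+\lambda^2+\lambda\mu}.$$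
   Context: Packet-skipping model: a single server with one extra waiting ("buffer") position. Packets arrive according to a Poisson process of rate $\lambda$; service times are i.i.d. exponential with rate $\mu$, independent of arrivals; service is non-preemptive. A packet arriving to an empty system (server idle, buffer empty) immediately enters service. A packet arriving while the server is busy is placed in the buffer; if the buffer already holds a packet, that packet is discarded and replaced ("overwritten") by the new one. Each packet arriving at time $s$ has absolute deadline $s+d$ for a fixed $d>0$; its lead-time at time $u$ is $s+d-u$. Thresholding policy with threshold $\theta\in[0,d]$: a buffered packet is removed (skipped, never served) as soon as its lead-time drops below $\theta$, i.e. once it has waited $d-\theta$ time units in the buffer; otherwise, when the server becomes free, the buffered packet enters service. A packet is served successfully if its service is completed no later than its absolute deadline. The goodput $\gamma(\theta)$ is the long-run number of successfully served packets per unit time. $L$ denotes the number of packets in the system (including the one in service) seen by an arriving packet just before its arrival, $L\in\{0,1,2\}$. *)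

theory Defs
  imports "HOL-Probability.Probability"
begin

text \<open>Deterministic sample-path description of the packet-skipping model.
  Packets are indexed by k = 0,1,2,...; packet k arrives at time arr_time A k
  (A i = i-th interarrival time, i.e. arrival time = A 0 + ... + A k) and,
  if it is ever served, needs service time S k.
  A system state is a pair (b, buf): b = time at which the server becomes free
  (completion time of the last started service; server idle at time u iff b \<le> u),
  buf = buffered packet (its arrival time, its index) or None.
  Time 0: empty system.\<close>

type_synonym qstate = "real \<times> (real \<times> nat) option"

definition arr_time :: "(nat \<Rightarrow> real) \<Rightarrow> nat \<Rightarrow> real" where
  "arr_time A k = (\<Sum>i\<le>k. A i)"

text \<open>Evolve the state up to time t (no arrivals in between). Within an
  interarrival interval at most one event can change the state: the server
  becomes free while a packet is buffered; that packet enters service iff it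
  has not yet been skipped (it has waited at most d - \<theta>), otherwise it has
  been removed and the server stays idle.\<close>
definition advance :: "real \<Rightarrow> real \<Rightarrow> (nat \<Rightarrow> real) \<Rightarrow> real \<Rightarrow> qstate \<Rightarrow> qstate" where
  "advance d \<theta> S t s = (case s of
      (b, None) \<Rightarrow> (b, None)
    | (b, Some (a, j)) \<Rightarrow>
        (if b \<le> t then (if b \<le> a + (d - \<theta>) then (b + S j, None) else (b, None))
         else (b, Some (a, j))))"

fun post_state :: "real \<Rightarrow> real \<Rightarrow> (nat \<Rightarrow> real) \<Rightarrow> (nat \<Rightarrow> real) \<Rightarrow> nat \<Rightarrow> qstate"
and pre_state :: "real \<Rightarrow> real \<Rightarrow> (nat \<Rightarrow> real) \<Rightarrow> (nat \<Rightarrow> real) \<Rightarrow> nat \<Rightarrow> qstate" where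
  "pre_state d \<theta> A S 0 = advance d \<theta> S (arr_time A 0) (0, None)"
| "pre_state d \<theta> A S (Suc k) = advance d \<theta> S (arr_time A (Suc k)) (post_state d \<theta> A S k)"
| "post_state d \<theta> A S k =
     (let t = arr_time A k; (b, buf) = pre_state d \<theta> A S k in
      if b \<le> t then (t + S k, None)     \<comment> \<open>empty system: immediate service\<close>
      else (b, Some (t, k)))"

definition finds_empty :: "real \<Rightarrow> real \<Rightarrow> (nat \<Rightarrow> real) \<Rightarrow> (nat \<Rightarrow> real) \<Rightarrow> nat \<Rightarrow> bool" where
  "finds_empty d \<theta> A S k = (fst (pre_state d \<theta> A S k) \<le> arr_time A k)"

text \<open>Start time of service of packet k, if it is ever served: either at its
  arrival (system empty) or, if buffered, when the server becomes free before
  the next arrival and it has not been skipped; otherwise it is overwritten or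
  skipped.\<close>
definition start_time :: "real \<Rightarrow> real \<Rightarrow> (nat \<Rightarrow> real) \<Rightarrow> (nat \<Rightarrow> real) \<Rightarrow> nat \<Rightarrow> real option" where
  "start_time d \<theta> A S k =
     (if finds_empty d \<theta> A S k then Some (arr_time A k)
      else (let b = fst (post_state d \<theta> A S k) in
            if b \<le> arr_time A (Suc k) \<and> b \<le> arr_time A k + (d - \<theta>) then Some b else None))"

definition served_ok :: "real \<Rightarrow> real \<Rightarrow> (nat \<Rightarrow> real) \<Rightarrow> (nat \<Rightarrow> real) \<Rightarrow> nat \<Rightarrow> bool" where
  "served_ok d \<theta> A S k =
     (\<exists>s. start_time d \<theta> A S k = Some s \<and> s + S k \<le> arr_time A k + d)"

definition completion_time :: "real \<Rightarrow> real \<Rightarrow> (nat \<Rightarrow> real) \<Rightarrow> (nat \<Rightarrow> real) \<Rightarrow> nat \<Rightarrow> real" where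
  "completion_time d \<theta> A S k = (case start_time d \<theta> A S k of Some s \<Rightarrow> s + S k | None \<Rightarrow> 0)"

definition goodput_count :: "real \<Rightarrow> real \<Rightarrow> (nat \<Rightarrow> real) \<Rightarrow> (nat \<Rightarrow> real) \<Rightarrow> real \<Rightarrow> nat" where
  "goodput_count d \<theta> A S t =
     card {k. served_ok d \<theta> A S k \<and> completion_time d \<theta> A S k \<le> t}"

end

theory Submission
  imports Defs "HOL-Library.Discrete_Functions"
begin

text \<open>Let \<open>R k\<close> be the residual service time found by packet \<open>k\<close> (nonpositive iff the system is empty).
  It obeys a recursion driven by one interarrival and one service time. By the memoryless property,
  given the past and \<open>R k > 0\<close> it is again exponential, so the busy indicator is a two-state Markov chain
  and the success probability of a packet given the past depends only on that indicator.
  The success of packet \<open>k\<close> is not known at the next arrival, because its service may still be running.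
  It is therefore split in two: the success indicator minus its conditional probability given all clocks
  except the packet's own service time, and that conditional probability minus its mean given the past.
  Both parts, and the centred increments of the busy chain, are orthogonal sequences, for which a strong law follows
  from second moments along squares and monotone interpolation. Multiplying by the arrival rate
  turns averages over packets into averages over time, since a successful packet leaves
  within \<open>d\<close> of its arrival. All integrals against fresh clocks are computed by resampling single coordinates of
  the infinite product of the exponential laws.\<close>

section \<open>Averages\<close>

text \<open>Every \<open>n\<close> lies between consecutive squares, whose ratio tends to 1, so
  monotonicity squeezes \<open>W n / n\<close>.\<close>

lemma tendsto_average_from_squares:
  fixes W :: "nat \<Rightarrow> real"
  assumes "mono W" and W0: "\<And>n. 0 \<le> W n"
    and lim: "(\<lambda>m. W (m\<^sup>2) / real (m\<^sup>2)) \<longlonglongrightarrow> c"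
  shows "(\<lambda>n. W n / real n) \<longlonglongrightarrow> c"
proof -
  have q: "filterlim floor_sqrt at_top sequentially"
    unfolding filterlim_at_top
  proof
    fix Z show "\<forall>\<^sub>F n in sequentially. Z \<le> floor_sqrt n"
      using eventually_ge_at_top[of "Z\<^sup>2"] by eventually_elim (simp add: le_floor_sqrtI)
  qed
  \<comment> \<open>\<open>l1\<close> and \<open>l2\<close> divide the value at one square by the
    neighbouring square, the denominators that the sandwich produces.\<close>
  have l1: "(\<lambda>m. (W (m\<^sup>2) / real (m\<^sup>2)) * (real m / real (Suc m))\<^sup>2) \<longlonglongrightarrow> c * 1\<^sup>2"
    by (intro tendsto_intros lim LIMSEQ_n_over_Suc_n)
  have l2: "(\<lambda>m. (W ((Suc m)\<^sup>2) / real ((Suc m)\<^sup>2)) * (real (Suc m) / real m)\<^sup>2) \<longlonglongrightarrow> c * 1\<^sup>2"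
    by (intro tendsto_intros LIMSEQ_Suc_n_over_n LIMSEQ_Suc[OF lim])
  have lo: "(\<lambda>n. W ((floor_sqrt n)\<^sup>2) / real ((Suc (floor_sqrt n))\<^sup>2)) \<longlonglongrightarrow> c"
    using filterlim_compose[OF l1 q] unfolding power_one mult_1_right
    by (rule Lim_transform_eventually)
       (rule eventually_mono[OF eventually_gt_at_top[of 0]], simp add: power_divide)
  have hi: "(\<lambda>n. W ((Suc (floor_sqrt n))\<^sup>2) / real ((floor_sqrt n)\<^sup>2)) \<longlonglongrightarrow> c"
    using filterlim_compose[OF l2 q] unfolding power_one mult_1_right
    by (rule Lim_transform_eventually)
       (rule eventually_mono[OF eventually_gt_at_top[of 0]], simp add: power_divide del: of_nat_Suc)
  show ?thesis
  proof (rule tendsto_sandwich[OF _ _ lo hi])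
    show "\<forall>\<^sub>F n in sequentially. W ((floor_sqrt n)\<^sup>2) / real ((Suc (floor_sqrt n))\<^sup>2) \<le> W n / real n"
      using eventually_gt_at_top[of 0]
    proof eventually_elim
      case (elim n)
      have "W ((floor_sqrt n)\<^sup>2) \<le> W n" using \<open>mono W\<close> by (simp add: monoD)
      moreover have "real n \<le> real ((Suc (floor_sqrt n))\<^sup>2)"
        using Suc_floor_sqrt_power2_gt[of n] by (simp only: of_nat_le_iff)
      ultimately show ?case using elim W0 by (intro frac_le) auto
    qed
    show "\<forall>\<^sub>F n in sequentially. W n / real n \<le> W ((Suc (floor_sqrt n))\<^sup>2) / real ((floor_sqrt n)\<^sup>2)"
      using eventually_gt_at_top[of 0]
    proof eventually_elim
      case (elim n)
      have "W n \<le> W ((Suc (floor_sqrt n))\<^sup>2)"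
        using \<open>mono W\<close> Suc_floor_sqrt_power2_gt[of n] by (simp add: monoD)
      moreover have "real ((floor_sqrt n)\<^sup>2) \<le> real n"
        by (simp only: of_nat_le_iff floor_sqrt_power2_le)
      ultimately show ?case using elim W0 by (intro frac_le) auto
    qed
  qed
qed

text \<open>Adding \<open>c\<close> makes the partial sums monotone, as interpolation between
  squares requires; the shift cancels in the limit.\<close>

lemma tendsto_average_of_nonneg_shift:
  fixes Y :: "nat \<Rightarrow> real"
  assumes lb: "\<And>k. - c \<le> Y k"
    and lim: "(\<lambda>m. (\<Sum>k<m\<^sup>2. Y k) / real (m\<^sup>2)) \<longlonglongrightarrow> 0"
  shows "(\<lambda>n. (\<Sum>k<n. Y k) / real n) \<longlonglongrightarrow> 0"
proof -
  let ?W = "\<lambda>n. \<Sum>k<n. Y k + c"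
  have pos: "0 \<le> Y k + c" for k using lb[of k] by simp
  have eq: "?W n / real n = (\<Sum>k<n. Y k) / real n + c" if "n > 0" for n
    using that by (simp add: sum.distrib add_divide_distrib)
  have "(\<lambda>n. ?W n / real n) \<longlonglongrightarrow> 0 + c"
  proof (rule tendsto_average_from_squares)
    show "mono ?W" using pos by (intro monoI sum_mono2) auto
    show "0 \<le> ?W n" for n using pos by (intro sum_nonneg) auto
    show "(\<lambda>m. ?W (m\<^sup>2) / real (m\<^sup>2)) \<longlonglongrightarrow> 0 + c"
      using tendsto_add[OF lim tendsto_const[of c]]
      by (rule Lim_transform_eventually)
         (rule eventually_mono[OF eventually_gt_at_top[of 0]], subst eq, simp_all)
  qed
  from tendsto_diff[OF this tendsto_const[of c]] show ?thesis
    by (simp, elim Lim_transform_eventually)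
       (rule eventually_mono[OF eventually_gt_at_top[of 0]], subst eq, simp_all)
qed

section \<open>Strong law for orthogonal sequences\<close>

lemma integrable_mult_of_squares:
  fixes f g :: "'a \<Rightarrow> real"
  assumes [measurable]: "f \<in> borel_measurable M" "g \<in> borel_measurable M"
    and int: "integrable M (\<lambda>x. (f x)\<^sup>2)" "integrable M (\<lambda>x. (g x)\<^sup>2)"
  shows "integrable M (\<lambda>x. f x * g x)"
proof (rule Bochner_Integration.integrable_bound)
  show "integrable M (\<lambda>x. (f x)\<^sup>2 + (g x)\<^sup>2)" using int by simp
  have "\<bar>x * y\<bar> \<le> x\<^sup>2 + y\<^sup>2" for x y :: real
  proof -
    have "2 * (\<bar>x\<bar> * \<bar>y\<bar>) \<le> x\<^sup>2 + y\<^sup>2"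
      using sum_squares_bound[of "\<bar>x\<bar>" "\<bar>y\<bar>"] by (simp add: mult.assoc)
    moreover have "0 \<le> \<bar>x\<bar> * \<bar>y\<bar>" by simp
    ultimately show ?thesis unfolding abs_mult by linarith
  qed
  then show "AE x in M. norm (f x * g x) \<le> norm ((f x)\<^sup>2 + (g x)\<^sup>2)" by simp
qed simp

text \<open>Orthogonality makes the second moments of partial sums grow at most linearly, so along
  squares the squared averages have summable expectations and vanish almost surely. The lower bound
  \<open>lb\<close> then fills the gaps between squares.\<close>

lemma (in prob_space) strong_law_orthogonal:
  fixes Y :: "nat \<Rightarrow> 'a \<Rightarrow> real"
  assumes [measurable]: "\<And>k. Y k \<in> borel_measurable M"
    and int: "\<And>k. integrable M (\<lambda>\<omega>. (Y k \<omega>)\<^sup>2)"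
    and orth: "\<And>j k. j < k \<Longrightarrow> expectation (\<lambda>\<omega>. Y j \<omega> * Y k \<omega>) = 0"
    and bnd: "\<And>k. expectation (\<lambda>\<omega>. (Y k \<omega>)\<^sup>2) \<le> C"
    and lb: "AE \<omega> in M. \<forall>k. - c \<le> Y k \<omega>"
  shows "AE \<omega> in M. (\<lambda>n. (\<Sum>k<n. Y k \<omega>) / real n) \<longlonglongrightarrow> 0"
proof -
  let ?T = "\<lambda>n \<omega>. \<Sum>k<n. Y k \<omega>"
  have C0: "0 \<le> C" using bnd[of 0] by (rule order_trans[rotated]) simp
  have intp: "integrable M (\<lambda>\<omega>. Y j \<omega> * Y k \<omega>)" for j k
    by (intro integrable_mult_of_squares int) simp_all
  have orth': "expectation (\<lambda>\<omega>. Y j \<omega> * Y k \<omega>) = 0" if "j \<noteq> k" for j k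
    using that orth[of j k] orth[of k j] by (cases "j < k") (auto simp: mult.commute)
  have T2: "(?T n \<omega>)\<^sup>2 = (\<Sum>j<n. \<Sum>k<n. Y j \<omega> * Y k \<omega>)" for n \<omega>
    by (simp add: power2_eq_square sum_product)
  have intT: "integrable M (\<lambda>\<omega>. (?T n \<omega>)\<^sup>2)" for n
    unfolding T2 using intp by simp
  have ET: "expectation (\<lambda>\<omega>. (?T n \<omega>)\<^sup>2) \<le> real n * C" for n
  proof -
    have "expectation (\<lambda>\<omega>. (?T n \<omega>)\<^sup>2) = (\<Sum>j<n. \<Sum>k<n. expectation (\<lambda>\<omega>. Y j \<omega> * Y k \<omega>))"
      unfolding T2 using intp by simp
    also have "\<dots> = (\<Sum>j<n. \<Sum>k<n. if k = j then expectation (\<lambda>\<omega>. (Y j \<omega>)\<^sup>2) else 0)"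
      by (intro sum.cong) (auto simp: orth' power2_eq_square)
    also have "\<dots> = (\<Sum>j<n. expectation (\<lambda>\<omega>. (Y j \<omega>)\<^sup>2))" by simp
    also have "\<dots> \<le> (\<Sum>j<n. C)" by (intro sum_mono bnd)
    finally show ?thesis by simp
  qed
  let ?G = "\<lambda>m \<omega>. (?T ((Suc m)\<^sup>2) \<omega> / real ((Suc m)\<^sup>2))\<^sup>2"
  have EG: "(\<integral>\<^sup>+\<omega>. ennreal (?G m \<omega>) \<partial>M) \<le> ennreal (C * (1 / real (Suc m)^2))" for m
  proof -
    let ?n = "(Suc m)\<^sup>2"
    have G: "?G m \<omega> = (?T ?n \<omega>)\<^sup>2 / (real ?n)\<^sup>2" for \<omega> by (simp only: power_divide)
    have ig: "integrable M (?G m)" unfolding G using intT by simp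
    have "expectation (?G m) = expectation (\<lambda>\<omega>. (?T ?n \<omega>)\<^sup>2) / (real ?n)\<^sup>2" unfolding G by simp
    also have "\<dots> \<le> real ?n * C / (real ?n)\<^sup>2" by (intro divide_right_mono ET) simp
    also have "\<dots> = C * (1 / real (Suc m)^2)" by (simp only: of_nat_power) (simp add: power2_eq_square del: of_nat_Suc)
    finally show ?thesis using ig by (subst nn_integral_eq_integral) (auto intro: ennreal_leI)
  qed
  have "(\<integral>\<^sup>+\<omega>. (\<Sum>m. ennreal (?G m \<omega>)) \<partial>M) = (\<Sum>m. \<integral>\<^sup>+\<omega>. ennreal (?G m \<omega>) \<partial>M)"
    by (intro nn_integral_suminf) simp
  also have "\<dots> \<le> (\<Sum>m. ennreal (C * (1 / real (Suc m)^2)))"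
    by (intro suminf_le EG) auto
  also have "\<dots> < \<infinity>"
  proof -
    have "summable (\<lambda>m. C * (1 / real (Suc m)^2))"
      using inverse_power_summable[of 2, where 'a = real]
      by (intro summable_mult, subst summable_Suc_iff) (simp add: inverse_eq_divide)
    then show ?thesis using C0 by (subst suminf_ennreal2) auto
  qed
  finally have "AE \<omega> in M. (\<Sum>m. ennreal (?G m \<omega>)) \<noteq> \<infinity>"
    by (intro nn_integral_PInf_AE) auto
  then show ?thesis using lb
  proof eventually_elim
    case (elim \<omega>)
    have "summable (\<lambda>m. ?G m \<omega>)"
      using elim(1) by (intro summable_suminf_not_top) auto
    from tendsto_real_sqrt[OF summable_LIMSEQ_zero[OF this]]
    have "(\<lambda>m. \<bar>?T ((Suc m)\<^sup>2) \<omega> / real ((Suc m)\<^sup>2)\<bar>) \<longlonglongrightarrow> 0"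
      by (simp only: real_sqrt_abs real_sqrt_zero)
    then have "(\<lambda>m. ?T ((Suc m)\<^sup>2) \<omega> / real ((Suc m)\<^sup>2)) \<longlonglongrightarrow> 0"
      by (rule tendsto_rabs_zero_cancel)
    then have "(\<lambda>m. ?T (m\<^sup>2) \<omega> / real (m\<^sup>2)) \<longlonglongrightarrow> 0"
      using filterlim_sequentially_Suc[of "\<lambda>m. ?T (m\<^sup>2) \<omega> / real (m\<^sup>2)"] by blast
    with elim(2) show ?case by (intro tendsto_average_of_nonneg_shift[of c]) auto
  qed
qed

section \<open>From averages over packets to rates per unit time\<close>

text \<open>\<open>N x\<close> is the first index whose time exceeds \<open>x\<close>, so
  \<open>t (N x - 1) \<le> x < t (N x)\<close> once \<open>N x\<close> is positive; dividing by
  \<open>N x\<close> squeezes \<open>x / N x\<close>.\<close>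

lemma counting_process_rate:
  fixes t :: "nat \<Rightarrow> real" and lam :: real
  assumes "lam > 0" and "mono t"
    and rate: "(\<lambda>k. t k / real k) \<longlonglongrightarrow> 1 / lam"
  obtains N :: "real \<Rightarrow> nat"
    where "\<And>x. {k. t k \<le> x} = {..<N x}"
      and "filterlim N sequentially at_top"
      and "((\<lambda>x. real (N x) / x) \<longlongrightarrow> lam) at_top"
proof -
  have tinf: "filterlim t at_top sequentially"
  proof -
    have "filterlim (\<lambda>k. (t k / real k) * real k) at_top sequentially"
      by (rule filterlim_tendsto_pos_mult_at_top[OF rate _ filterlim_real_sequentially])
         (use \<open>lam > 0\<close> in simp)
    then show ?thesis
      by (rule filterlim_mono_eventually[OF _ order_refl order_refl])
         (rule eventually_mono[OF eventually_gt_at_top[of 0]], simp)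
  qed
  define N where "N x = (LEAST n. x < t n)" for x
  have ex: "\<exists>n. x < t n" for x
    using tinf by (auto simp: filterlim_at_top_dense eventually_sequentially)
  have hit: "x < t (N x)" for x unfolding N_def using ex by (rule LeastI_ex)
  have below: "t k \<le> x" if "k < N x" for k x
    using not_less_Least[of k "\<lambda>n. x < t n"] that by (auto simp: N_def)
  have set: "{k. t k \<le> x} = {..<N x}" for x
  proof safe
    fix k assume "t k \<le> x"
    show "k < N x"
    proof (rule ccontr)
      assume "\<not> k < N x"
      with \<open>mono t\<close> have "t (N x) \<le> t k" by (simp add: monoD)
      with hit[of x] \<open>t k \<le> x\<close> show False by simp
    qed
  qed (use below in auto)
  have Ninf: "filterlim N sequentially at_top"
    unfolding filterlim_at_top
  proof
    fix n show "\<forall>\<^sub>F x in at_top. n \<le> N x"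
      using eventually_ge_at_top[of "t n"]
    proof eventually_elim
      case (elim x)
      then have "n \<in> {k. t k \<le> x}" by simp
      then show ?case unfolding set by simp
    qed
  qed
  have up: "((\<lambda>x. t (N x) / real (N x)) \<longlongrightarrow> 1 / lam) at_top"
    by (rule filterlim_compose[OF rate Ninf])
  have "(\<lambda>k. t k / real k * (real k / real (Suc k))) \<longlonglongrightarrow> 1 / lam * 1"
    by (intro tendsto_intros rate LIMSEQ_n_over_Suc_n)
  then have "(\<lambda>k. t k / real (Suc k)) \<longlonglongrightarrow> 1 / lam"
    by (simp, elim Lim_transform_eventually)
       (rule eventually_mono[OF eventually_gt_at_top[of 0]], simp)
  then have "(\<lambda>k. t (k - 1) / real k) \<longlonglongrightarrow> 1 / lam"
    using filterlim_sequentially_Suc[of "\<lambda>k. t (k - 1) / real k"] by (simp del: of_nat_Suc)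
  then have lo: "((\<lambda>x. t (N x - 1) / real (N x)) \<longlongrightarrow> 1 / lam) at_top"
    by (rule filterlim_compose[OF _ Ninf])
  have Npos: "\<forall>\<^sub>F x in at_top. 0 < N x"
    using Ninf by (auto simp: filterlim_at_top Suc_le_eq dest: spec[of _ "Suc 0"])
  have "((\<lambda>x. x / real (N x)) \<longlongrightarrow> 1 / lam) at_top"
  proof (rule tendsto_sandwich[OF _ _ lo up])
    show "\<forall>\<^sub>F x in at_top. t (N x - 1) / real (N x) \<le> x / real (N x)"
      using Npos by eventually_elim (auto intro!: divide_right_mono below)
    show "\<forall>\<^sub>F x in at_top. x / real (N x) \<le> t (N x) / real (N x)"
      using hit by (intro always_eventually allI divide_right_mono) (auto intro: less_imp_le)
  qed
  from tendsto_inverse[OF this] \<open>lam > 0\<close>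
  have "((\<lambda>x. real (N x) / x) \<longlongrightarrow> lam) at_top" by (simp add: inverse_eq_divide)
  with set Ninf that show ?thesis by blast
qed

text \<open>A success that has left by \<open>x\<close> arrived by \<open>x\<close>, and one that
  arrived by \<open>x - d\<close> has left by \<open>x\<close>. The count lies between the successes
  among the first \<open>N (x - d)\<close> and the first \<open>N x\<close> packets, and both have
  the same rate.\<close>

lemma rate_of_delayed_count:
  fixes t c :: "nat \<Rightarrow> real"
  assumes "lam > 0" and "mono t"
    and rate: "(\<lambda>k. t k / real k) \<longlonglongrightarrow> 1 / lam"
    and dens: "(\<lambda>n. real (card {k. k < n \<and> ok k}) / real n) \<longlonglongrightarrow> g"
    and c: "\<And>k. ok k \<Longrightarrow> t k \<le> c k \<and> c k \<le> t k + d"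
  shows "((\<lambda>x. real (card {k. ok k \<and> c k \<le> x}) / x) \<longlongrightarrow> lam * g) at_top"
proof -
  obtain N where N: "\<And>x. {k. t k \<le> x} = {..<N x}"
      and Ninf: "filterlim N sequentially at_top"
      and Nx: "((\<lambda>x. real (N x) / x) \<longlongrightarrow> lam) at_top"
    using counting_process_rate[OF assms(1-3)] by blast
  have N': "t k \<le> x \<longleftrightarrow> k < N x" for k x using N[of x] by auto
  let ?C = "\<lambda>x. real (card {k. k < N x \<and> ok k})"
  have "((\<lambda>x. (?C x / real (N x)) * (real (N x) / x)) \<longlongrightarrow> g * lam) at_top"
    by (intro tendsto_mult Nx filterlim_compose[OF dens Ninf])
  moreover have "\<forall>\<^sub>F x in at_top. 0 < N x"
    using Ninf by (auto simp: filterlim_at_top Suc_le_eq dest: spec[of _ "Suc 0"])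
  ultimately have hi: "((\<lambda>x. ?C x / x) \<longlongrightarrow> lam * g) at_top"
    by (auto elim!: Lim_transform_eventually eventually_mono simp: mult.commute)
  have sh: "filterlim (\<lambda>x::real. x - d) at_top at_top"
    using filterlim_tendsto_add_at_top[OF tendsto_const[of "- d"] filterlim_ident] by simp
  \<comment> \<open>The factor \<open>1 - d / x\<close> turns division by \<open>x - d\<close> into
    division by \<open>x\<close>.\<close>
  have "((\<lambda>x::real. 1 - d / x) \<longlongrightarrow> 1 - 0) at_top"
    by (intro tendsto_diff tendsto_const real_tendsto_divide_at_top[OF tendsto_const filterlim_ident])
  from tendsto_mult[OF filterlim_compose[OF hi sh] this]
  have "((\<lambda>x. ?C (x - d) / (x - d) * (1 - d / x)) \<longlongrightarrow> lam * g) at_top" by simp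
  then have lo: "((\<lambda>x. ?C (x - d) / x) \<longlongrightarrow> lam * g) at_top"
  proof (rule Lim_transform_eventually)
    show "\<forall>\<^sub>F x in at_top. ?C (x - d) / (x - d) * (1 - d / x) = ?C (x - d) / x"
      using eventually_gt_at_top[of 0] eventually_gt_at_top[of d]
      by eventually_elim (simp add: field_simps)
  qed
  show ?thesis
  proof (rule tendsto_sandwich[OF _ _ lo hi])
    show "\<forall>\<^sub>F x in at_top. ?C (x - d) / x \<le> real (card {k. ok k \<and> c k \<le> x}) / x"
      using eventually_gt_at_top[of 0]
    proof eventually_elim
      case (elim x)
      have "{k. ok k \<and> c k \<le> x} \<subseteq> {..<N x}" using c N' by fastforce
      moreover have "{k. k < N (x - d) \<and> ok k} \<subseteq> {k. ok k \<and> c k \<le> x}"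
        using c by (fastforce simp: N'[symmetric])
      ultimately have "card {k. k < N (x - d) \<and> ok k} \<le> card {k. ok k \<and> c k \<le> x}"
        by (intro card_mono) (auto intro: finite_subset)
      with elim show ?case by (intro divide_right_mono) auto
    qed
    show "\<forall>\<^sub>F x in at_top. real (card {k. ok k \<and> c k \<le> x}) / x \<le> ?C x / x"
      using eventually_gt_at_top[of 0]
    proof eventually_elim
      case (elim x)
      have "{k. ok k \<and> c k \<le> x} \<subseteq> {k. k < N x \<and> ok k}" using c N' by fastforce
      then have "card {k. ok k \<and> c k \<le> x} \<le> card {k. k < N x \<and> ok k}" by (intro card_mono) auto
      with elim show ?case by (intro divide_right_mono) auto
    qed
  qed
qed

text \<open>The sum of \<open>b (Suc k) - b k\<close> telescopes to a bounded quantity, so the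
  average \<open>x\<close> of \<open>b\<close> asymptotically solves
  \<open>x = \<alpha> + \<beta> * x\<close>.\<close>

lemma tendsto_average_of_recursion:
  fixes b :: "nat \<Rightarrow> real"
  assumes b: "\<And>k. \<bar>b k\<bar> \<le> 1" and "\<beta> \<noteq> 1"
    and lim: "(\<lambda>n. (\<Sum>k<n. b (Suc k) - (\<alpha> + \<beta> * b k)) / real n) \<longlonglongrightarrow> 0"
  shows "(\<lambda>n. (\<Sum>k<n. b k) / real n) \<longlonglongrightarrow> \<alpha> / (1 - \<beta>)"
proof -
  have "(\<lambda>n. (b n - b 0) / real n) \<longlonglongrightarrow> 0"
  proof (rule Lim_null_comparison)
    show "(\<lambda>n. 2 / real n) \<longlonglongrightarrow> 0" by (rule lim_const_over_n)
    have "\<bar>b n - b 0\<bar> \<le> 2" for n using b[of n] b[of 0] by linarith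
    then show "\<forall>\<^sub>F n in sequentially. norm ((b n - b 0) / real n) \<le> 2 / real n"
      by (intro always_eventually allI) (simp add: divide_right_mono)
  qed
  from tendsto_add[OF tendsto_diff[OF lim this] tendsto_const[of \<alpha>]]
  have "(\<lambda>n. ((\<Sum>k<n. b (Suc k) - (\<alpha> + \<beta> * b k)) / real n - (b n - b 0) / real n + \<alpha>) / (1 - \<beta>)) \<longlonglongrightarrow> \<alpha> / (1 - \<beta>)"
    using \<open>\<beta> \<noteq> 1\<close> by (intro tendsto_divide) auto
  then show ?thesis
  proof (rule Lim_transform_eventually)
    show "\<forall>\<^sub>F n in sequentially. ((\<Sum>k<n. b (Suc k) - (\<alpha> + \<beta> * b k)) / real n - (b n - b 0) / real n + \<alpha>) / (1 - \<beta>)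
        = (\<Sum>k<n. b k) / real n"
      using eventually_gt_at_top[of 0]
    proof eventually_elim
      case (elim n)
      have "(\<Sum>k<n. b (Suc k) - (\<alpha> + \<beta> * b k)) = (\<Sum>k<n. b (Suc k) - b k) + (1 - \<beta>) * (\<Sum>k<n. b k) - real n * \<alpha>"
        by (simp add: sum.distrib sum_subtractf sum_distrib_left algebra_simps)
      also have "(\<Sum>k<n. b (Suc k) - b k) = b n - b 0" by (rule sum_lessThan_telescope)
      finally have "((\<Sum>k<n. b (Suc k) - (\<alpha> + \<beta> * b k)) / real n - (b n - b 0) / real n + \<alpha>)
        = (1 - \<beta>) * ((\<Sum>k<n. b k) / real n)"
        using elim by (simp add: field_simps)
      then show ?case using \<open>\<beta> \<noteq> 1\<close> by simp
    qed
  qed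
qed

section \<open>Exponential laws\<close>

definition exp_measure :: "real \<Rightarrow> real measure" where
  "exp_measure l = density lborel (\<lambda>x. ennreal (exponential_density l x))"

lemma sets_exp_measure [simp, measurable_cong]: "sets (exp_measure l) = sets borel"
  and space_exp_measure [simp]: "space (exp_measure l) = UNIV"
  by (simp_all add: exp_measure_def)

lemma prob_space_exp_measure: "0 < l \<Longrightarrow> prob_space (exp_measure l)"
  unfolding exp_measure_def by (rule prob_space_exponential_density)

lemma AE_exp_measure_nonneg: "AE x in exp_measure l. 0 \<le> x"
  unfolding exp_measure_def
  by (subst AE_density) (auto simp: exponential_density_def)

lemma integral_exp_measure:
  fixes f :: "real \<Rightarrow> real"
  assumes "0 < l" and [measurable]: "f \<in> borel_measurable borel"
  shows "(\<integral>x. f x \<partial>exp_measure l) = (\<integral>x. exponential_density l x * f x \<partial>lborel)"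
  unfolding exp_measure_def using assms
  by (subst integral_density) (auto simp: exponential_density_nonneg)

text \<open>Memoryless property: for \<open>x \<ge> 0\<close> the density at \<open>c + x\<close> is
  \<open>exp (- l * c)\<close> times the density at \<open>x\<close>.\<close>

lemma integral_exp_measure_shift:
  fixes f :: "real \<Rightarrow> real"
  assumes l: "0 < l" and c: "0 \<le> c" and [measurable]: "f \<in> borel_measurable borel"
  shows "(\<integral>x. (if c \<le> x then f (x - c) else 0) \<partial>exp_measure l) = exp (- l * c) * (\<integral>x. f x \<partial>exp_measure l)"
proof -
  have "(\<integral>x. (if c \<le> x then f (x - c) else 0) \<partial>exp_measure l)
      = (\<integral>x. exponential_density l x * (if c \<le> x then f (x - c) else 0) \<partial>lborel)"
    using l by (intro integral_exp_measure) auto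
  also have "\<dots> = (\<integral>x. exponential_density l (c + 1 * x) * (if c \<le> c + 1 * x then f (c + 1 * x - c) else 0) \<partial>lborel)"
    by (subst lborel_integral_real_affine[where c = 1 and t = c]) auto
  also have "\<dots> = (\<integral>x. exp (- l * c) * (exponential_density l x * f x) \<partial>lborel)"
    using c by (intro Bochner_Integration.integral_cong)
      (auto simp: exponential_density_def exp_add exp_diff exp_minus field_simps)
  finally show ?thesis using l by (simp add: integral_exp_measure)
qed

lemma AE_exp_measure_neq: "AE x in exp_measure l. x \<noteq> c"
  unfolding exp_measure_def by (subst AE_density) (use AE_lborel_singleton[of c] in auto)

lemma integral_exp_measure_shift':
  fixes f :: "real \<Rightarrow> real"
  assumes l: "0 < l" and c: "0 \<le> c" and [measurable]: "f \<in> borel_measurable borel"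
  shows "(\<integral>x. (if c < x then f (x - c) else 0) \<partial>exp_measure l) = exp (- l * c) * (\<integral>x. f x \<partial>exp_measure l)"
  unfolding integral_exp_measure_shift[OF assms, symmetric]
  by (rule integral_cong_AE) (use AE_exp_measure_neq[of c l] in auto)

text \<open>Multiplying the density of rate \<open>l\<close> by \<open>exp (- c * x)\<close> gives
  \<open>l / (l + c)\<close> times the density of rate \<open>l + c\<close>. The constant
  \<open>c\<close> may be negative as long as the new rate is positive.\<close>

lemma integral_exp_measure_tilt:
  fixes f :: "real \<Rightarrow> real"
  assumes "0 < l" and "0 < l + c" and [measurable]: "f \<in> borel_measurable borel"
  shows "(\<integral>x. exp (- c * x) * f x \<partial>exp_measure l) = l / (l + c) * (\<integral>x. f x \<partial>exp_measure (l + c))"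
proof -
  have "(\<integral>x. exp (- c * x) * f x \<partial>exp_measure l)
      = (\<integral>x. l / (l + c) * (exponential_density (l + c) x * f x) \<partial>lborel)"
    using assms by (subst integral_exp_measure; (intro Bochner_Integration.integral_cong)?)
      (auto simp: exponential_density_def exp_add exp_diff exp_minus field_simps)
  then show ?thesis using assms by (simp add: integral_exp_measure)
qed

lemma distributed_exp_measure: "distributed (exp_measure l) lborel (\<lambda>x. x) (exponential_density l)"
  unfolding distributed_def by (auto simp: exp_measure_def intro!: distr_id2)

lemma integral_exp_measure_atMost:
  assumes "0 < l" and "0 \<le> D"
  shows "(\<integral>x. (if x \<le> D then 1 else 0) \<partial>exp_measure l) = 1 - exp (- l * D)"
proof -
  interpret prob_space "exp_measure l" using assms by (intro prob_space_exp_measure)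
  have "(\<integral>x. (if x \<le> D then 1 else 0) \<partial>exp_measure l) = (\<integral>x. indicator {x. x \<le> D} x \<partial>exp_measure l)"
    by (intro Bochner_Integration.integral_cong) auto
  also have "\<dots> = measure (exp_measure l) {x. x \<le> D}" by simp
  also have "\<dots> = 1 - exp (- D * l)"
    using exponential_distributedD_le[OF distributed_exp_measure assms(2,1)] by simp
  finally show ?thesis by (simp add: mult.commute)
qed

lemma integral_exp_measure_atMost_tilt:
  assumes "0 < l" and "0 < l + c" and "0 \<le> D"
  shows "(\<integral>x. (if x \<le> D then exp (- c * x) else 0) \<partial>exp_measure l) = l / (l + c) * (1 - exp (- (l + c) * D))"
proof -
  have "(\<integral>x. (if x \<le> D then exp (- c * x) else 0) \<partial>exp_measure l)
      = (\<integral>x. exp (- c * x) * (if x \<le> D then 1 else 0) \<partial>exp_measure l)"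
    by (intro Bochner_Integration.integral_cong) auto
  then show ?thesis using assms
    by (simp only:, subst integral_exp_measure_tilt) (auto simp: integral_exp_measure_atMost)
qed

lemma integral_exp_measure_exp:
  assumes "0 < l" and "0 < l + c"
  shows "(\<integral>x. exp (- c * x) \<partial>exp_measure l) = l / (l + c)"
proof -
  interpret prob_space "exp_measure (l + c)" using assms by (intro prob_space_exp_measure)
  show ?thesis using integral_exp_measure_tilt[OF assms, of "\<lambda>_. 1"] by (simp add: prob_space[simplified])
qed

section \<open>Pathwise recursion for the residual service time\<close>

text \<open>Residual service time found by the next arrival, given the residual time \<^term>\<open>r\<close> found by the
  current one (idle server iff \<^term>\<open>r \<le> 0\<close>), the service time \<^term>\<open>s\<close> of the current packet and the
  interarrival time \<^term>\<open>a\<close>.\<close>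

definition resid_step :: "real \<Rightarrow> real \<Rightarrow> real \<Rightarrow> real \<Rightarrow> real" where
  "resid_step D r a s = (if r \<le> 0 then s - a else if r \<le> a \<and> r \<le> D then r + s - a else r - a)"

lemma measurable_resid_step [measurable]:
  assumes [measurable]: "f \<in> borel_measurable M" "g \<in> borel_measurable M" "h \<in> borel_measurable M"
  shows "(\<lambda>x. resid_step D (f x) (g x) (h x)) \<in> borel_measurable M"
  unfolding resid_step_def by measurable

text \<open>At an idle server the value is minus the time since it became free, counted from time 0
  before the first service; only the sign of such a value enters the recursion.\<close>

definition resid :: "real \<Rightarrow> real \<Rightarrow> (nat \<Rightarrow> real) \<Rightarrow> (nat \<Rightarrow> real) \<Rightarrow> nat \<Rightarrow> real" where
  "resid d \<theta> A S k = fst (pre_state d \<theta> A S k) - arr_time A k"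

lemma arr_time_Suc: "arr_time A (Suc k) = arr_time A k + A (Suc k)"
  by (simp add: arr_time_def)

lemma resid_0: "resid d \<theta> A S 0 = - A 0"
  by (simp add: resid_def advance_def arr_time_def)

text \<open>Packet \<open>k\<close> displaces whatever was buffered, so it is the only candidate to
  start service before the next arrival. Hence the buffer content drops out, and the service time
  used is \<open>S k\<close>.\<close>

lemma resid_Suc: "resid d \<theta> A S (Suc k) = resid_step (d - \<theta>) (resid d \<theta> A S k) (A (Suc k)) (S k)"
  by (simp add: resid_def resid_step_def advance_def arr_time_Suc Let_def split: prod.split)

lemma finds_empty_iff: "finds_empty d \<theta> A S k \<longleftrightarrow> resid d \<theta> A S k \<le> 0"
  by (simp add: finds_empty_def resid_def)

lemma fst_post_state:
  "\<not> finds_empty d \<theta> A S k \<Longrightarrow> fst (post_state d \<theta> A S k) = arr_time A k + resid d \<theta> A S k"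
  by (cases "pre_state d \<theta> A S k") (simp add: finds_empty_def resid_def Let_def)

lemma served_ok_iff:
  "served_ok d \<theta> A S k \<longleftrightarrow>
    (if resid d \<theta> A S k \<le> 0 then S k \<le> d
     else resid d \<theta> A S k \<le> A (Suc k) \<and> resid d \<theta> A S k \<le> d - \<theta> \<and> resid d \<theta> A S k + S k \<le> d)"
  using fst_post_state[of d \<theta> A S k]
  by (auto simp: served_ok_def start_time_def finds_empty_iff arr_time_Suc Let_def simp del: post_state.simps)

lemma completion_time_bounds:
  assumes "served_ok d \<theta> A S k" and "0 \<le> S k"
  shows "arr_time A k \<le> completion_time d \<theta> A S k \<and> completion_time d \<theta> A S k \<le> arr_time A k + d"
  using assms fst_post_state[of d \<theta> A S k]
  by (auto simp: served_ok_def completion_time_def start_time_def finds_empty_iff Let_def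
      simp del: post_state.simps split: if_splits)

text \<open>If packet \<open>k\<close> starts service before the next arrival, the residual is a
  fresh service time minus the part already served, and memorylessness produces the factor
  \<open>m\<close>. If the old service is still running then, the residual is the fixed number
  \<open>r - a\<close>, and \<open>m\<close> appears only after integrating over
  \<open>r\<close>.\<close>

lemma integral_resid_step:
  fixes f :: "real \<Rightarrow> real"
  assumes mu: "0 < mu" and [measurable]: "f \<in> borel_measurable borel" and r: "0 \<le> D" "0 \<le> a"
  defines "m \<equiv> \<integral>x. f x \<partial>exp_measure mu"
  shows "(\<integral>s. (if 0 < resid_step D r a s then f (resid_step D r a s) else 0) \<partial>exp_measure mu) =
    (if r \<le> 0 then exp (- mu * a) * m
     else if r \<le> a \<and> r \<le> D then exp (- mu * (a - r)) * m
     else if a < r then f (r - a) else 0)"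
proof -
  interpret prob_space "exp_measure mu" using mu by (rule prob_space_exp_measure)
  consider "r \<le> 0" | "0 < r" "r \<le> a" "r \<le> D" | "0 < r" "\<not> (r \<le> a \<and> r \<le> D)" by linarith
  then show ?thesis
  proof cases
    case 1
    then show ?thesis
      using integral_exp_measure_shift'[OF mu r(2), of f]
      by (simp add: resid_step_def m_def cong: if_cong)
  next
    case 2
    have "(\<integral>s. (if 0 < resid_step D r a s then f (resid_step D r a s) else 0) \<partial>exp_measure mu)
      = (\<integral>s. (if a - r < s then f (s - (a - r)) else 0) \<partial>exp_measure mu)"
      using 2 by (intro Bochner_Integration.integral_cong) (auto simp: resid_step_def algebra_simps)
    then show ?thesis
      using 2 integral_exp_measure_shift'[OF mu, of "a - r" f] by (simp add: m_def)
  next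
    case 3
    then show ?thesis by (auto simp: resid_step_def prob_space[simplified])
  qed
qed

section \<open>The canonical probability space\<close>

lemma (in prob_space) abs_expectation_le:
  fixes f :: "'a \<Rightarrow> real"
  assumes "f \<in> borel_measurable M" and b: "\<And>x. \<bar>f x\<bar> \<le> B"
  shows "\<bar>expectation f\<bar> \<le> B"
proof -
  have "integrable M f" using assms by (intro integrable_const_bound[of _ B]) auto
  moreover have "f x \<le> B" "- B \<le> f x" for x using b[of x] by auto
  ultimately have "expectation f \<le> B" "- B \<le> expectation f"
    by (auto intro!: integral_le_const integral_ge_const)
  then show ?thesis by simp
qed

lemma measurable_compose2:
  assumes "(\<lambda>(x, y). h x y) \<in> borel_measurable (borel \<Otimes>\<^sub>M borel)"
    and "f \<in> borel_measurable N" "g \<in> borel_measurable N"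
  shows "(\<lambda>x. h (f x) (g x)) \<in> borel_measurable N"
  using measurable_compose[OF measurable_Pair[OF assms(2,3)] assms(1)] by simp

lemma measurable_compose3:
  assumes "(\<lambda>(x, y, z). h x y z) \<in> borel_measurable (borel \<Otimes>\<^sub>M borel \<Otimes>\<^sub>M borel)"
    and "f \<in> borel_measurable N" "g \<in> borel_measurable N" "k \<in> borel_measurable N"
  shows "(\<lambda>x. h (f x) (g x) (k x)) \<in> borel_measurable N"
  using measurable_compose[OF measurable_Pair[OF assms(2) measurable_Pair[OF assms(3,4)]] assms(1)] by simp

locale packet_skipping =
  fixes lam mu d \<theta> :: real
  assumes lam: "0 < lam" and mu: "0 < mu" and d: "0 < d" and \<theta>: "0 \<le> \<theta>" "\<theta> \<le> d"
begin

text \<open>One product indexed by a sum type holds both families, \<open>Inl\<close> for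
  interarrival and \<open>Inr\<close> for service times, so that each clock is a single coordinate
  that can be redrawn.\<close>

definition law :: "nat + nat \<Rightarrow> real measure" where
  "law i = (case i of Inl _ \<Rightarrow> exp_measure lam | Inr _ \<Rightarrow> exp_measure mu)"

definition P :: "(nat + nat \<Rightarrow> real) measure" where
  "P = Pi\<^sub>M UNIV law"

abbreviation R :: "nat \<Rightarrow> (nat + nat \<Rightarrow> real) \<Rightarrow> real" where
  "R k w \<equiv> resid d \<theta> (\<lambda>i. w (Inl i)) (\<lambda>i. w (Inr i)) k"

lemma law_simps [simp]: "law (Inl k) = exp_measure lam" "law (Inr k) = exp_measure mu"
  by (simp_all add: law_def)

lemma sets_law [simp, measurable_cong]: "sets (law i) = sets borel" and space_law [simp]: "space (law i) = UNIV"
  by (cases i; simp)+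

lemma prob_space_law: "prob_space (law i)"
  by (cases i) (auto intro: prob_space_exp_measure lam mu)

lemma prob_space_P: "prob_space P"
  unfolding P_def by (intro prob_space_PiM prob_space_law)

sublocale P: prob_space P by (rule prob_space_P)
sublocale Elam: prob_space "exp_measure lam" by (rule prob_space_exp_measure[OF lam])
sublocale Emu: prob_space "exp_measure mu" by (rule prob_space_exp_measure[OF mu])

lemma sets_P: "sets P = sets (Pi\<^sub>M UNIV (\<lambda>_. borel))"
  unfolding P_def by (intro sets_PiM_cong) auto

lemma space_P [simp]: "space P = UNIV"
  by (simp add: P_def space_PiM)

lemma measurable_coord: "(\<lambda>w. w i) \<in> borel_measurable P"
  by (subst measurable_cong_sets[OF sets_P refl]) (rule measurable_component_singleton, simp)

lemma measurable_resid [measurable]: "R k \<in> borel_measurable P"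
proof (induction k)
  case 0
  then show ?case by (simp add: resid_0 measurable_coord)
next
  case (Suc k)
  note [measurable] = this measurable_coord
  show ?case unfolding resid_Suc by measurable
qed

section \<open>Resampling single coordinates\<close>

lemma measurable_fun_upd_P [measurable]:
  "(\<lambda>(y, w). w(i := y)) \<in> measurable (law i \<Otimes>\<^sub>M P) P"
proof -
  note [measurable] = measurable_compose[OF measurable_snd measurable_coord]
  have "(\<lambda>x. \<lambda>j. if j = i then fst x else snd x j) \<in> measurable (law i \<Otimes>\<^sub>M P) (Pi\<^sub>M UNIV (\<lambda>_. borel))"
    by (rule measurable_PiM_single') (auto simp: space_PiM PiE_def)
  then show ?thesis
    by (simp add: measurable_cong_sets[OF refl sets_P] split_beta' fun_upd_def)
qed

lemma distr_resample: "distr (law i \<Otimes>\<^sub>M P) P (\<lambda>(y, w). w(i := y)) = P"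
  using distr_pair_PiM_eq_PiM[of UNIV law i] prob_space_law by (simp add: P_def)

lemma integrable_resample:
  fixes F :: "(nat + nat \<Rightarrow> real) \<Rightarrow> real"
  assumes "integrable P F"
  shows "integrable (law i \<Otimes>\<^sub>M P) (\<lambda>(y, w). F (w(i := y)))"
proof -
  have "integrable (distr (law i \<Otimes>\<^sub>M P) P (\<lambda>(y, w). w(i := y))) F"
    using assms by (simp add: distr_resample)
  from integrable_distr[OF measurable_fun_upd_P this] show ?thesis
    by (simp add: split_beta')
qed

text \<open>Redrawing coordinate \<open>i\<close> independently leaves the product law unchanged.
  With Fubini this takes the place of conditioning on all other coordinates.\<close>

lemma integral_resample:
  fixes F :: "(nat + nat \<Rightarrow> real) \<Rightarrow> real"
  assumes "integrable P F"
  shows "(\<integral>w. F w \<partial>P) = (\<integral>w. \<integral>y. F (w(i := y)) \<partial>law i \<partial>P)"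
proof -
  interpret L: prob_space "law i" by (rule prob_space_law)
  interpret pair_sigma_finite "law i" P by unfold_locales
  have "F \<in> borel_measurable P" using assms by simp
  then have "(\<integral>w. F w \<partial>P) = (\<integral>z. F (case z of (y, w) \<Rightarrow> w(i := y)) \<partial>(law i \<Otimes>\<^sub>M P))"
    by (subst distr_resample[symmetric, of i], subst integral_distr) auto
  also have "\<dots> = (\<integral>(y, w). F (w(i := y)) \<partial>(law i \<Otimes>\<^sub>M P))"
    by (simp add: split_beta')
  also have "\<dots> = (\<integral>w. \<integral>y. F (w(i := y)) \<partial>law i \<partial>P)"
    by (subst integral_snd[symmetric, OF integrable_resample[OF assms]]) simp
  finally show ?thesis .
qed

section \<open>Test functions of the past\<close>

text \<open>Invariance under changes of future coordinates replaces measurability in a filtration.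
  Interarrival times up to index \<open>k\<close> are past at the arrival of packet
  \<open>k\<close>, but service times only below \<open>k\<close>; hence \<open><\<close> in one
  clause and \<open>\<le>\<close> in the other.\<close>

definition adapted :: "nat \<Rightarrow> ((nat + nat \<Rightarrow> real) \<Rightarrow> real) \<Rightarrow> bool" where
  "adapted k Z \<longleftrightarrow> (\<forall>w y j. (k < j \<longrightarrow> Z (w(Inl j := y)) = Z w) \<and> (k \<le> j \<longrightarrow> Z (w(Inr j := y)) = Z w))"

lemma adapted_mono: "adapted j Z \<Longrightarrow> j \<le> k \<Longrightarrow> adapted k Z"
  unfolding adapted_def by force

lemma adapted_R: "adapted k (R k)"
proof (induction k)
  case 0
  then show ?case by (simp add: adapted_def resid_0)
next
  case (Suc k)
  then have "adapted (Suc k) (R k)" by (rule adapted_mono) simp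
  then show ?case by (auto simp: adapted_def resid_Suc)
qed

text \<open>Tested against \<^term>\<open>Z\<close>, the residual service time found by packet \<^term>\<open>k\<close> is exponential
  whenever it is positive. The service time of packet \<^term>\<open>k\<close> itself is not part of the past: it
  is fresh even if that packet starts service on arrival.\<close>

definition memoryless :: "nat \<Rightarrow> ((nat + nat \<Rightarrow> real) \<Rightarrow> real) \<Rightarrow> bool" where
  "memoryless k Z \<longleftrightarrow> (\<forall>f\<in>borel_measurable borel. (\<exists>B. \<forall>x. \<bar>f x\<bar> \<le> B) \<longrightarrow>
     (\<integral>w. Z w * (if 0 < R k w then f (R k w) else 0) \<partial>P)
      = (\<integral>w. Z w * (if 0 < R k w then 1 else 0) \<partial>P) * (\<integral>x. f x \<partial>exp_measure mu))"

text \<open>These bounded test functions stand in for the events known at an arrival.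
  \<open>memoryless\<close> is imposed separately, since an adapted function could see the exact
  value of \<open>R k\<close> and destroy its exponential law.\<close>

definition past :: "nat \<Rightarrow> ((nat + nat \<Rightarrow> real) \<Rightarrow> real) set" where
  "past k = {Z \<in> borel_measurable P. (\<exists>B. \<forall>w. \<bar>Z w\<bar> \<le> B) \<and> adapted k Z \<and> memoryless k Z}"

section \<open>Integrals over the two fresh clocks of one step\<close>

lemma integrable_bounded_P:
  fixes F :: "(nat + nat \<Rightarrow> real) \<Rightarrow> real"
  assumes "F \<in> borel_measurable P" "\<And>w. \<bar>F w\<bar> \<le> B"
  shows "integrable P F"
  using assms by (intro P.integrable_const_bound[of _ B]) auto

text \<open>Neither \<open>Z\<close> nor \<open>R k\<close> depends on the next interarrival time or
  on the service time of packet \<open>k\<close>, so both clocks are redrawn in turn with everything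
  else fixed.\<close>

lemma integral_fresh:
  fixes H :: "real \<Rightarrow> real \<Rightarrow> real \<Rightarrow> real"
  assumes [measurable]: "Z \<in> borel_measurable P" and Zb: "\<And>w. \<bar>Z w\<bar> \<le> B" and ad: "adapted k Z"
    and Hm: "(\<lambda>(r, a, s). H r a s) \<in> borel_measurable (borel \<Otimes>\<^sub>M borel \<Otimes>\<^sub>M borel)"
    and Hb: "\<And>r a s. \<bar>H r a s\<bar> \<le> C"
  shows "(\<integral>w. Z w * H (R k w) (w (Inl (Suc k))) (w (Inr k)) \<partial>P)
      = (\<integral>w. Z w * (\<integral>a. \<integral>s. H (R k w) a s \<partial>exp_measure mu \<partial>exp_measure lam) \<partial>P)"
proof -
  have Hm' [measurable]: "(\<lambda>x. H (f x) (g x) (h x)) \<in> borel_measurable N"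
    if "f \<in> borel_measurable N" "g \<in> borel_measurable N" "h \<in> borel_measurable N" for f g h and N :: "'c measure"
    using that by (rule measurable_compose3[OF Hm])
  note [measurable] = measurable_coord
  have Hs: "(\<lambda>s. H r a s) \<in> borel_measurable (exp_measure mu)" for r a
    by (rule Hm') (simp_all add: measurable_ident_sets)
  have B0: "0 \<le> B" using Zb[of undefined] by linarith
  have C0: "0 \<le> C" using Hb[of 0 0 0] by linarith
  let ?F = "\<lambda>w. Z w * H (R k w) (w (Inl (Suc k))) (w (Inr k))"
  have bd: "\<bar>Z w * x\<bar> \<le> B * C" if "\<bar>x\<bar> \<le> C" for w x
    unfolding abs_mult using that Zb B0 by (intro mult_mono) auto
  have "(\<integral>w. ?F w \<partial>P) = (\<integral>w. \<integral>s. ?F (w(Inr k := s)) \<partial>law (Inr k) \<partial>P)"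
    by (intro integral_resample integrable_bounded_P[of _ "B * C"] bd Hb) measurable
  also have "\<dots> = (\<integral>w. Z w * (\<integral>s. H (R k w) (w (Inl (Suc k))) s \<partial>exp_measure mu) \<partial>P)" (is "_ = (\<integral>w. ?G w \<partial>P)")
    using ad adapted_R[of k] by (simp add: adapted_def)
  also have "\<dots> = (\<integral>w. \<integral>a. ?G (w(Inl (Suc k) := a)) \<partial>law (Inl (Suc k)) \<partial>P)"
  proof (intro integral_resample integrable_bounded_P[of _ "B * C"] bd)
    show "\<bar>\<integral>s. H (R k w) (w (Inl (Suc k))) s \<partial>exp_measure mu\<bar> \<le> C" for w
      by (rule Emu.abs_expectation_le[OF Hs Hb])
  qed measurable
  also have "\<dots> = (\<integral>w. Z w * (\<integral>a. \<integral>s. H (R k w) a s \<partial>exp_measure mu \<partial>exp_measure lam) \<partial>P)"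
    using ad adapted_R[of k] by (simp add: adapted_def)
  finally show ?thesis .
qed

abbreviation busy :: "nat \<Rightarrow> (nat + nat \<Rightarrow> real) \<Rightarrow> real" where
  "busy k w \<equiv> (if 0 < R k w then 1 else 0)"

lemma pastD:
  assumes "Z \<in> past k"
  shows "Z \<in> borel_measurable P" "\<exists>B. \<forall>w. \<bar>Z w\<bar> \<le> B" "adapted k Z" "memoryless k Z"
  using assms by (auto simp: past_def)

lemma memorylessD:
  assumes "memoryless k Z" "f \<in> borel_measurable borel" "\<And>x. \<bar>f x\<bar> \<le> B"
  shows "(\<integral>w. Z w * (if 0 < R k w then f (R k w) else 0) \<partial>P)
      = (\<integral>w. Z w * busy k w \<partial>P) * (\<integral>x. f x \<partial>exp_measure mu)"
  using assms unfolding memoryless_def by blast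

text \<open>On the idle event the inner integral is the constant \<open>h0\<close>; on the busy
  event \<open>memoryless\<close> replaces \<open>R k\<close> by an independent exponential
  variable, which gives \<open>h1\<close>. The conditional mean thus depends on the past only
  through the busy indicator.\<close>

lemma integral_given_past:
  fixes H :: "real \<Rightarrow> real \<Rightarrow> real \<Rightarrow> real"
  assumes Z: "Z \<in> past k"
    and Hm: "(\<lambda>(r, a, s). H r a s) \<in> borel_measurable (borel \<Otimes>\<^sub>M borel \<Otimes>\<^sub>M borel)"
    and Hb: "\<And>r a s. \<bar>H r a s\<bar> \<le> C"
    and idle: "\<And>r. r \<le> 0 \<Longrightarrow> (\<integral>a. \<integral>s. H r a s \<partial>exp_measure mu \<partial>exp_measure lam) = h0"
    and busy: "(\<integral>r. \<integral>a. \<integral>s. H r a s \<partial>exp_measure mu \<partial>exp_measure lam \<partial>exp_measure mu) = h1"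
  shows "(\<integral>w. Z w * H (R k w) (w (Inl (Suc k))) (w (Inr k)) \<partial>P)
      = h0 * (\<integral>w. Z w * (1 - busy k w) \<partial>P) + h1 * (\<integral>w. Z w * busy k w \<partial>P)"
proof -
  note [measurable] = pastD(1)[OF Z]
  obtain B where B: "\<And>w. \<bar>Z w\<bar> \<le> B" using pastD(2)[OF Z] by blast
  have [measurable]: "(\<lambda>x. H (f x) (g x) (h x)) \<in> borel_measurable N"
    if "f \<in> borel_measurable N" "g \<in> borel_measurable N" "h \<in> borel_measurable N" for f g h and N :: "'c measure"
    using that by (rule measurable_compose3[OF Hm])
  define Hbar where "Hbar r = (\<integral>a. \<integral>s. H r a s \<partial>exp_measure mu \<partial>exp_measure lam)" for r
  have Hbar_m [measurable]: "Hbar \<in> borel_measurable borel"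
    unfolding Hbar_def[abs_def] by measurable
  have Hs: "(\<lambda>s. H r a s) \<in> borel_measurable (exp_measure mu)" for r a
    by (rule measurable_compose3[OF Hm]) (simp_all add: measurable_ident_sets)
  have Ha: "(\<lambda>a. \<integral>s. H r a s \<partial>exp_measure mu) \<in> borel_measurable (exp_measure lam)" for r
    by (rule Emu.borel_measurable_lebesgue_integral, unfold split_beta', rule measurable_compose3[OF Hm]) simp_all
  have Hbar_b: "\<bar>Hbar r\<bar> \<le> C" for r
    unfolding Hbar_def by (intro Elam.abs_expectation_le Emu.abs_expectation_le Hs Ha Hb)
  have B0: "0 \<le> B" using B[of undefined] by linarith
  have C0: "0 \<le> C" using Hb[of 0 0 0] by linarith
  have bd: "\<bar>Z w * x\<bar> \<le> B * D" if "\<bar>x\<bar> \<le> D" for w x D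
    unfolding abs_mult using that B B0 by (intro mult_mono) auto
  have "(\<integral>w. Z w * H (R k w) (w (Inl (Suc k))) (w (Inr k)) \<partial>P) = (\<integral>w. Z w * Hbar (R k w) \<partial>P)"
    unfolding Hbar_def by (rule integral_fresh[OF pastD(1)[OF Z] B pastD(3)[OF Z] Hm Hb])
  also have "\<dots> = (\<integral>w. h0 * (Z w * (1 - busy k w)) + Z w * (if 0 < R k w then Hbar (R k w) else 0) \<partial>P)"
    using idle by (intro Bochner_Integration.integral_cong) (auto simp: Hbar_def)
  also have "\<dots> = h0 * (\<integral>w. Z w * (1 - busy k w) \<partial>P) + (\<integral>w. Z w * (if 0 < R k w then Hbar (R k w) else 0) \<partial>P)"
  proof (subst Bochner_Integration.integral_add)
    show "integrable P (\<lambda>w. h0 * (Z w * (1 - busy k w)))"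
      by (intro integrable_mult_right integrable_bounded_P[of _ "B * 1"] bd) auto
    show "integrable P (\<lambda>w. Z w * (if 0 < R k w then Hbar (R k w) else 0))"
      using Hbar_b C0 by (intro integrable_bounded_P[of _ "B * C"] bd) auto
  qed simp
  also have "(\<integral>w. Z w * (if 0 < R k w then Hbar (R k w) else 0) \<partial>P) = (\<integral>w. Z w * busy k w \<partial>P) * h1"
    unfolding memorylessD[OF pastD(4)[OF Z] Hbar_m Hbar_b] by (simp only: Hbar_def[abs_def] busy)
  finally show ?thesis by (simp only: mult.commute)
qed

lemma integral_resid_step_idle:
  fixes f :: "real \<Rightarrow> real" and h :: "real \<Rightarrow> real"
  assumes [measurable]: "f \<in> borel_measurable borel" "h \<in> borel_measurable borel" and "r \<le> 0"
  shows "(\<integral>a. \<integral>s. h a * (if 0 < resid_step (d - \<theta>) r a s then f (resid_step (d - \<theta>) r a s) else 0)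
            \<partial>exp_measure mu \<partial>exp_measure lam)
      = (\<integral>x. f x \<partial>exp_measure mu) * (\<integral>a. h a * exp (- mu * a) \<partial>exp_measure lam)"
proof -
  have "(\<integral>a. \<integral>s. h a * (if 0 < resid_step (d - \<theta>) r a s then f (resid_step (d - \<theta>) r a s) else 0)
            \<partial>exp_measure mu \<partial>exp_measure lam)
      = (\<integral>a. (\<integral>x. f x \<partial>exp_measure mu) * (h a * exp (- mu * a)) \<partial>exp_measure lam)"
  proof (rule integral_cong_AE)
    show "AE a in exp_measure lam.
        (\<integral>s. h a * (if 0 < resid_step (d - \<theta>) r a s then f (resid_step (d - \<theta>) r a s) else 0) \<partial>exp_measure mu)
        = (\<integral>x. f x \<partial>exp_measure mu) * (h a * exp (- mu * a))"
      using AE_exp_measure_nonneg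
      by eventually_elim (use \<open>r \<le> 0\<close> \<theta> in \<open>simp add: integral_resid_step[OF mu]\<close>)
  qed measurable
  then show ?thesis by simp
qed

text \<open>The next arrival finds the server busy if a new service has begun and not ended, or if
  the old one outlasts \<open>a\<close>. Both cases leave an exponential residual, hence the common
  factor. In the second case the excess \<open>r - a\<close> is exponential only if the weight does
  not depend on \<open>r\<close>, which \<open>hc\<close> ensures.\<close>

lemma integral_resid_step_busy:
  fixes f :: "real \<Rightarrow> real" and h :: "real \<Rightarrow> real \<Rightarrow> real"
  assumes fm [measurable]: "f \<in> borel_measurable borel" and fb: "\<And>x. \<bar>f x\<bar> \<le> B"
    and hm: "(\<lambda>(r, a). h r a) \<in> borel_measurable (borel \<Otimes>\<^sub>M borel)" and hb: "\<And>r a. \<bar>h r a\<bar> \<le> C"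
    and hc: "\<And>r a. 0 \<le> a \<Longrightarrow> a < r \<Longrightarrow> h r a = c"
  shows "(\<integral>r. \<integral>a. \<integral>s. h r a * (if 0 < resid_step (d - \<theta>) r a s then f (resid_step (d - \<theta>) r a s) else 0)
            \<partial>exp_measure mu \<partial>exp_measure lam \<partial>exp_measure mu)
      = (\<integral>x. f x \<partial>exp_measure mu) *
         ((\<integral>r. \<integral>a. (if r \<le> a \<and> r \<le> d - \<theta> then h r a * exp (- mu * (a - r)) else 0)
             \<partial>exp_measure lam \<partial>exp_measure mu) + c * (\<integral>a. exp (- mu * a) \<partial>exp_measure lam))"
proof -
  let ?D = "d - \<theta>"
  let ?m = "\<integral>x. f x \<partial>exp_measure mu"
  have [measurable]: "(\<lambda>x. h (f x) (g x)) \<in> borel_measurable N"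
    if "f \<in> borel_measurable N" "g \<in> borel_measurable N" for f g and N :: "'c measure"
    using that by (rule measurable_compose2[OF hm])
  have hr [measurable]: "(\<lambda>a. h r a) \<in> borel_measurable borel" for r
    using measurable_compose[OF _ hm, of "\<lambda>a. (r, a)" borel] by simp
  have B0: "0 \<le> B" using fb[of 0] by linarith
  have C0: "0 \<le> C" using hb[of 0 0] by linarith
  \<comment> \<open>\<open>?g\<close> belongs to a new service begun before the next arrival,
    \<open>?k\<close> to an old service that outlasts it.\<close>
  let ?g = "\<lambda>r a. if r \<le> a \<and> r \<le> ?D then h r a * exp (- mu * (a - r)) else 0"
  let ?k = "\<lambda>r a. if a < r then f (r - a) else 0"
  have gb: "\<bar>?g r a\<bar> \<le> C" for r a
  proof -
    have "\<bar>h r a\<bar> * exp (- mu * (a - r)) \<le> C * 1" if "r \<le> a"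
      using that mu C0 by (intro mult_mono hb) auto
    then show ?thesis using C0 by (auto simp: abs_mult)
  qed
  have kb: "\<bar>?k r a\<bar> \<le> B" for r a using fb B0 by auto
  have intg: "integrable (exp_measure lam) (?g r)" for r
    by (rule Elam.integrable_const_bound[of _ C], use gb in simp, measurable)
  have intk: "integrable (exp_measure lam) (?k r)" for r
    by (rule Elam.integrable_const_bound[of _ B], use kb in simp, measurable)
  have "(\<integral>r. \<integral>a. \<integral>s. h r a * (if 0 < resid_step ?D r a s then f (resid_step ?D r a s) else 0)
            \<partial>exp_measure mu \<partial>exp_measure lam \<partial>exp_measure mu)
      = (\<integral>r. ?m * (\<integral>a. ?g r a \<partial>exp_measure lam) + c * (\<integral>a. ?k r a \<partial>exp_measure lam) \<partial>exp_measure mu)"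
  proof (rule integral_cong_AE)
    have "(\<integral>a. \<integral>s. h r a * (if 0 < resid_step ?D r a s then f (resid_step ?D r a s) else 0)
            \<partial>exp_measure mu \<partial>exp_measure lam)
        = ?m * (\<integral>a. ?g r a \<partial>exp_measure lam) + c * (\<integral>a. ?k r a \<partial>exp_measure lam)"
      if r: "0 < r" for r
    proof -
      have "(\<integral>a. \<integral>s. h r a * (if 0 < resid_step ?D r a s then f (resid_step ?D r a s) else 0)
            \<partial>exp_measure mu \<partial>exp_measure lam) = (\<integral>a. ?m * ?g r a + c * ?k r a \<partial>exp_measure lam)"
      proof (rule integral_cong_AE)
        show "AE a in exp_measure lam.
          (\<integral>s. h r a * (if 0 < resid_step ?D r a s then f (resid_step ?D r a s) else 0) \<partial>exp_measure mu)
           = ?m * ?g r a + c * ?k r a"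
          using AE_exp_measure_nonneg
        proof eventually_elim
          case (elim a)
          have "(if r \<le> 0 then exp (- mu * a) * ?m
                 else if r \<le> a \<and> r \<le> ?D then exp (- mu * (a - r)) * ?m else if a < r then f (r - a) else 0)
              = (if r \<le> a \<and> r \<le> ?D then exp (- mu * (a - r)) * ?m else if a < r then f (r - a) else 0)"
            using r by (simp only: not_le[symmetric] if_False)
          moreover have "0 \<le> ?D" using \<theta> by simp
          ultimately have "(\<integral>s. (if 0 < resid_step ?D r a s then f (resid_step ?D r a s) else 0) \<partial>exp_measure mu)
            = (if r \<le> a \<and> r \<le> ?D then exp (- mu * (a - r)) * ?m else if a < r then f (r - a) else 0)"
            using integral_resid_step[OF mu fm _ elim, of ?D r] by (simp only:)
          moreover have "h r a = c" if "a < r" using hc elim that by blast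
          ultimately show ?case unfolding integral_mult_right_zero by (simp only: split: if_split) auto
        qed
      qed measurable
      then show ?thesis using intg intk by simp
    qed
    then show "AE r in exp_measure mu.
        (\<integral>a. \<integral>s. h r a * (if 0 < resid_step ?D r a s then f (resid_step ?D r a s) else 0)
            \<partial>exp_measure mu \<partial>exp_measure lam)
        = ?m * (\<integral>a. ?g r a \<partial>exp_measure lam) + c * (\<integral>a. ?k r a \<partial>exp_measure lam)"
      using AE_exp_measure_nonneg[of mu] AE_exp_measure_neq[of 0 mu] by auto
  qed measurable
  also have "\<dots> = ?m * (\<integral>r. \<integral>a. ?g r a \<partial>exp_measure lam \<partial>exp_measure mu)
       + c * (\<integral>r. \<integral>a. ?k r a \<partial>exp_measure lam \<partial>exp_measure mu)"
  proof -
    have "integrable (exp_measure mu) (\<lambda>r. \<integral>a. ?g r a \<partial>exp_measure lam)"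
    proof (rule Emu.integrable_const_bound[of _ C])
      show "AE r in exp_measure mu. norm (\<integral>a. ?g r a \<partial>exp_measure lam) \<le> C"
        using gb by (auto intro!: AE_I2 Elam.abs_expectation_le borel_measurable_integrable[OF intg])
    qed measurable
    moreover have "integrable (exp_measure mu) (\<lambda>r. \<integral>a. ?k r a \<partial>exp_measure lam)"
    proof (rule Emu.integrable_const_bound[of _ B])
      show "AE r in exp_measure mu. norm (\<integral>a. ?k r a \<partial>exp_measure lam) \<le> B"
        using kb by (auto intro!: AE_I2 Elam.abs_expectation_le borel_measurable_integrable[OF intk])
    qed measurable
    ultimately show ?thesis by simp
  qed
  \<comment> \<open>Exchanging the order integrates the exponential \<open>r\<close> first, so
    memorylessness applies at the fixed level \<open>a\<close>.\<close>
  also have "(\<integral>r. \<integral>a. ?k r a \<partial>exp_measure lam \<partial>exp_measure mu)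
      = (\<integral>a. \<integral>r. ?k r a \<partial>exp_measure mu \<partial>exp_measure lam)"
  proof -
    interpret L: pair_prob_space "exp_measure lam" "exp_measure mu" ..
    have "integrable (exp_measure lam \<Otimes>\<^sub>M exp_measure mu) (\<lambda>(a, r). ?k r a)"
    proof (rule L.integrable_const_bound[of _ B])
      show "AE x in exp_measure lam \<Otimes>\<^sub>M exp_measure mu. norm (case x of (a, r) \<Rightarrow> ?k r a) \<le> B"
        using kb by (auto intro!: AE_I2)
    qed measurable
    from L.Fubini_integral[OF this] show ?thesis by simp
  qed
  also have "\<dots> = (\<integral>a. exp (- mu * a) * ?m \<partial>exp_measure lam)"
  proof (rule integral_cong_AE)
    show "AE a in exp_measure lam. (\<integral>r. ?k r a \<partial>exp_measure mu) = exp (- mu * a) * ?m"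
      using AE_exp_measure_nonneg by eventually_elim (rule integral_exp_measure_shift'[OF mu _ fm])
  qed measurable
  finally show ?thesis by (simp add: algebra_simps)
qed

text \<open>The mean of \<open>f\<close> splits off with a cofactor independent of \<open>f\<close>;
  this is the exponential law of the next residual, tested against the weighted
  \<open>Z\<close>.\<close>

lemma integral_past_step:
  fixes f :: "real \<Rightarrow> real" and h :: "real \<Rightarrow> real \<Rightarrow> real"
  assumes Z: "Z \<in> past k"
    and fm [measurable]: "f \<in> borel_measurable borel" and fb: "\<And>x. \<bar>f x\<bar> \<le> B"
    and hm: "(\<lambda>(r, a). h r a) \<in> borel_measurable (borel \<Otimes>\<^sub>M borel)" and hb: "\<And>r a. \<bar>h r a\<bar> \<le> C"
    and h0: "\<And>r a. r \<le> 0 \<Longrightarrow> h r a = h 0 a"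
    and hc: "\<And>r a. 0 \<le> a \<Longrightarrow> a < r \<Longrightarrow> h r a = c"
  shows "(\<integral>w. Z w * h (R k w) (w (Inl (Suc k))) * (if 0 < R (Suc k) w then f (R (Suc k) w) else 0) \<partial>P)
    = (\<integral>x. f x \<partial>exp_measure mu) *
      ((\<integral>a. h 0 a * exp (- mu * a) \<partial>exp_measure lam) * (\<integral>w. Z w * (1 - busy k w) \<partial>P)
       + ((\<integral>r. \<integral>a. (if r \<le> a \<and> r \<le> d - \<theta> then h r a * exp (- mu * (a - r)) else 0)
             \<partial>exp_measure lam \<partial>exp_measure mu) + c * (\<integral>a. exp (- mu * a) \<partial>exp_measure lam))
          * (\<integral>w. Z w * busy k w \<partial>P))"
proof -
  have [measurable]: "(\<lambda>x. h (f x) (g x)) \<in> borel_measurable N"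
    if "f \<in> borel_measurable N" "g \<in> borel_measurable N" for f g and N :: "'c measure"
    using that by (rule measurable_compose2[OF hm])
  have hr: "(\<lambda>a. h r a) \<in> borel_measurable borel" for r
    using measurable_compose[OF _ hm, of "\<lambda>a. (r, a)" borel] by simp
  have B0: "0 \<le> B" using fb[of 0] by linarith
  have C0: "0 \<le> C" using hb[of 0 0] by linarith
  let ?H = "\<lambda>r a s. h r a * (if 0 < resid_step (d - \<theta>) r a s then f (resid_step (d - \<theta>) r a s) else 0)"
  have "(\<integral>w. Z w * ?H (R k w) (w (Inl (Suc k))) (w (Inr k)) \<partial>P)
    = (\<integral>x. f x \<partial>exp_measure mu) * (\<integral>a. h 0 a * exp (- mu * a) \<partial>exp_measure lam)
        * (\<integral>w. Z w * (1 - busy k w) \<partial>P)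
      + (\<integral>x. f x \<partial>exp_measure mu) * ((\<integral>r. \<integral>a. (if r \<le> a \<and> r \<le> d - \<theta> then h r a * exp (- mu * (a - r)) else 0)
             \<partial>exp_measure lam \<partial>exp_measure mu) + c * (\<integral>a. exp (- mu * a) \<partial>exp_measure lam))
          * (\<integral>w. Z w * busy k w \<partial>P)"
  proof (rule integral_given_past[OF Z])
    show "(\<lambda>(r, a, s). ?H r a s) \<in> borel_measurable (borel \<Otimes>\<^sub>M borel \<Otimes>\<^sub>M borel)"
      by measurable
    show "\<bar>?H r a s\<bar> \<le> C * B" for r a s
      unfolding abs_mult using hb fb B0 C0 by (intro mult_mono) auto
    show "(\<integral>a. \<integral>s. ?H r a s \<partial>exp_measure mu \<partial>exp_measure lam)
        = (\<integral>x. f x \<partial>exp_measure mu) * (\<integral>a. h 0 a * exp (- mu * a) \<partial>exp_measure lam)" if "r \<le> 0" for r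
      unfolding integral_resid_step_idle[OF fm hr that] using h0[OF that] by simp
    show "(\<integral>r. \<integral>a. \<integral>s. ?H r a s \<partial>exp_measure mu \<partial>exp_measure lam \<partial>exp_measure mu)
      = (\<integral>x. f x \<partial>exp_measure mu) * ((\<integral>r. \<integral>a. (if r \<le> a \<and> r \<le> d - \<theta> then h r a * exp (- mu * (a - r)) else 0)
             \<partial>exp_measure lam \<partial>exp_measure mu) + c * (\<integral>a. exp (- mu * a) \<partial>exp_measure lam))"
      by (rule integral_resid_step_busy[OF fm fb hm hb hc])
  qed
  then show ?thesis by (simp only: resid_Suc mult.assoc ring_distribs)
qed

text \<open>The weight \<open>h\<close> may reveal \<open>r\<close> once that service has ended,
  since a positive next residual then stems from a fresh service time. While the old service is
  running, \<open>hc\<close> keeps \<open>r\<close> hidden.\<close>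

lemma past_step:
  fixes h :: "real \<Rightarrow> real \<Rightarrow> real"
  assumes Z: "Z \<in> past k"
    and hm: "(\<lambda>(r, a). h r a) \<in> borel_measurable (borel \<Otimes>\<^sub>M borel)" and hb: "\<And>r a. \<bar>h r a\<bar> \<le> C"
    and h0: "\<And>r a. r \<le> 0 \<Longrightarrow> h r a = h 0 a"
    and hc: "\<And>r a. 0 \<le> a \<Longrightarrow> a < r \<Longrightarrow> h r a = c"
  shows "(\<lambda>w. Z w * h (R k w) (w (Inl (Suc k)))) \<in> past (Suc k)"
proof -
  have [measurable]: "(\<lambda>x. h (f x) (g x)) \<in> borel_measurable N"
    if "f \<in> borel_measurable N" "g \<in> borel_measurable N" for f g and N :: "'c measure"
    using that by (rule measurable_compose2[OF hm])
  note [measurable] = pastD(1)[OF Z]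
  obtain B where B: "\<And>w. \<bar>Z w\<bar> \<le> B" using pastD(2)[OF Z] by blast
  have "\<bar>Z w * h r a\<bar> \<le> B * C" for w r a
    unfolding abs_mult using B hb by (intro mult_mono) (auto intro: order_trans[OF abs_ge_zero])
  moreover have "adapted (Suc k) (\<lambda>w. Z w * h (R k w) (w (Inl (Suc k))))"
    using adapted_mono[OF pastD(3)[OF Z], of "Suc k"] adapted_mono[OF adapted_R, of k "Suc k"]
    by (simp add: adapted_def)
  moreover have "memoryless (Suc k) (\<lambda>w. Z w * h (R k w) (w (Inl (Suc k))))"
    unfolding memoryless_def
  proof (intro ballI impI, elim exE)
    fix f :: "real \<Rightarrow> real" and B
    assume f: "f \<in> borel_measurable borel" "\<forall>x. \<bar>f x\<bar> \<le> B"
    \<comment> \<open>\<open>X\<close> is the cofactor common to all \<open>g\<close>; the choice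
      \<open>g = 1\<close> identifies it.\<close>
    obtain X where X: "(\<integral>w. Z w * h (R k w) (w (Inl (Suc k))) * (if 0 < R (Suc k) w then g (R (Suc k) w) else 0) \<partial>P)
        = (\<integral>x. g x \<partial>exp_measure mu) * X"
      if "g \<in> borel_measurable borel" "\<And>x. \<bar>g x\<bar> \<le> B'" for g B'
      using integral_past_step[OF Z _ _ hm hb h0 hc] by meson
    have "(\<integral>w. Z w * h (R k w) (w (Inl (Suc k))) * busy (Suc k) w \<partial>P) = X"
      using X[of "\<lambda>_. 1" 1] Emu.prob_space by simp
    then show "(\<integral>w. Z w * h (R k w) (w (Inl (Suc k))) * (if 0 < R (Suc k) w then f (R (Suc k) w) else 0) \<partial>P)
      = (\<integral>w. Z w * h (R k w) (w (Inl (Suc k))) * busy (Suc k) w \<partial>P) * (\<integral>x. f x \<partial>exp_measure mu)"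
      using X[OF f(1) f(2)[rule_format]] by (simp only: mult.commute[of X])
  qed
  moreover have "(\<lambda>w. Z w * h (R k w) (w (Inl (Suc k)))) \<in> borel_measurable P"
    using measurable_coord by measurable
  ultimately show ?thesis unfolding past_def by blast
qed

section \<open>Members of the past and their strong law\<close>

lemma AE_coord_nonneg: "AE w in P. \<forall>i. 0 \<le> w i"
proof -
  have "AE w in P. 0 \<le> w i" for i
  proof -
    have "law i = exp_measure lam \<or> law i = exp_measure mu" by (cases i) auto
    then have "AE x in law i. 0 \<le> x"
      by (elim disjE) (erule ssubst, rule AE_exp_measure_nonneg)+
    then show ?thesis unfolding P_def by (intro AE_PiM_component prob_space_law) simp_all
  qed
  then show ?thesis by (simp add: AE_all_countable)
qed

text \<open>The first packet almost surely finds the system empty, so both sides of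
  \<open>memoryless\<close> vanish.\<close>

lemma past_const: "(\<lambda>_. c) \<in> past 0"
proof -
  have zero: "(\<integral>w. c * (if 0 < R 0 w then f (R 0 w) else 0) \<partial>P) = 0"
    if [measurable]: "f \<in> borel_measurable borel" for f :: "real \<Rightarrow> real"
  proof -
    have "(\<integral>w. c * (if 0 < R 0 w then f (R 0 w) else 0) \<partial>P) = (\<integral>w. 0 \<partial>P)"
    proof (rule integral_cong_AE)
      show "AE w in P. c * (if 0 < R 0 w then f (R 0 w) else 0) = 0"
        using AE_coord_nonneg
      proof eventually_elim
        case (elim w)
        then have "\<not> 0 < R 0 w" by (simp add: resid_0 not_less)
        then show ?case by simp
      qed
    qed measurable
    then show ?thesis by simp
  qed
  have "memoryless 0 (\<lambda>_. c)"
    unfolding memoryless_def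
  proof (intro ballI impI)
    fix f :: "real \<Rightarrow> real" assume "f \<in> borel_measurable borel"
    then show "(\<integral>w. c * (if 0 < R 0 w then f (R 0 w) else 0) \<partial>P)
        = (\<integral>w. c * busy 0 w \<partial>P) * (\<integral>x. f x \<partial>exp_measure mu)"
      using zero[of "\<lambda>_. 1"] by (simp only: zero borel_measurable_const mult_zero_left)
  qed
  then show ?thesis by (auto simp: past_def adapted_def)
qed

lemma past_mono:
  assumes "Z \<in> past j" and "j \<le> k"
  shows "Z \<in> past k"
  using assms(2)
proof (induction k rule: dec_induct)
  case (step k)
  then show ?case using past_step[of Z k "\<lambda>_ _. 1" 1 1] by simp
qed (rule assms(1))

lemma past_const': "(\<lambda>_. c) \<in> past k"
  by (rule past_mono[OF past_const]) simp

lemma past_lincomb: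
  assumes Z: "Z \<in> past k" and Y: "Y \<in> past k"
  shows "(\<lambda>w. \<alpha> * Z w + \<beta> * Y w) \<in> past k"
proof -
  note [measurable] = pastD(1)[OF Z] pastD(1)[OF Y]
  obtain B where B: "\<And>w. \<bar>Z w\<bar> \<le> B" using pastD(2)[OF Z] by blast
  obtain C where C: "\<And>w. \<bar>Y w\<bar> \<le> C" using pastD(2)[OF Y] by blast
  have "\<bar>\<alpha> * Z w + \<beta> * Y w\<bar> \<le> \<bar>\<alpha>\<bar> * B + \<bar>\<beta>\<bar> * C" for w
    by (rule order_trans[OF abs_triangle_ineq]) (auto simp: abs_mult intro!: add_mono mult_left_mono B C)
  moreover have "adapted k (\<lambda>w. \<alpha> * Z w + \<beta> * Y w)"
    using pastD(3)[OF Z] pastD(3)[OF Y] by (simp add: adapted_def)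
  moreover have "memoryless k (\<lambda>w. \<alpha> * Z w + \<beta> * Y w)"
    unfolding memoryless_def
  proof (intro ballI impI, elim exE)
    fix f :: "real \<Rightarrow> real" and D
    assume f [measurable]: "f \<in> borel_measurable borel" and D: "\<forall>x. \<bar>f x\<bar> \<le> D"
    have lin: "(\<integral>w. (\<alpha> * Z w + \<beta> * Y w) * (if 0 < R k w then g (R k w) else 0) \<partial>P)
       = \<alpha> * (\<integral>w. Z w * (if 0 < R k w then g (R k w) else 0) \<partial>P)
         + \<beta> * (\<integral>w. Y w * (if 0 < R k w then g (R k w) else 0) \<partial>P)"
      if [measurable]: "g \<in> borel_measurable borel" and D: "\<And>x. \<bar>g x\<bar> \<le> D" for g D
    proof -
      have D0: "0 \<le> D" using D[of 0] by linarith
      have "integrable P (\<lambda>w. Z w * (if 0 < R k w then g (R k w) else 0))"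
        by (rule integrable_bounded_P[of _ "B * D"])
           (use B D D0 in \<open>auto simp: abs_mult intro!: mult_mono mult_nonneg_nonneg intro: order_trans[OF abs_ge_zero]\<close>)
      moreover have "integrable P (\<lambda>w. Y w * (if 0 < R k w then g (R k w) else 0))"
        by (rule integrable_bounded_P[of _ "C * D"])
           (use C D D0 in \<open>auto simp: abs_mult intro!: mult_mono mult_nonneg_nonneg intro: order_trans[OF abs_ge_zero]\<close>)
      ultimately show ?thesis by (simp add: distrib_right mult.assoc)
    qed
    show "(\<integral>w. (\<alpha> * Z w + \<beta> * Y w) * (if 0 < R k w then f (R k w) else 0) \<partial>P)
      = (\<integral>w. (\<alpha> * Z w + \<beta> * Y w) * busy k w \<partial>P) * (\<integral>x. f x \<partial>exp_measure mu)"
      using lin[OF f D[rule_format]] lin[of "\<lambda>_. 1" 1]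
        memorylessD[OF pastD(4)[OF Z] f D[rule_format]] memorylessD[OF pastD(4)[OF Y] f D[rule_format]]
      by (simp add: algebra_simps)
  qed
  ultimately show ?thesis unfolding past_def by auto
qed

text \<open>\<open>1 - busy k\<close> is zero wherever the other factor in \<open>memoryless\<close>
  can be nonzero, so both sides vanish for it; linearity then gives \<open>busy k\<close>.\<close>

lemma past_busy: "busy k \<in> past k"
proof -
  have "(\<lambda>w. 1 - busy k w) \<in> past k"
  proof -
    have "adapted k (\<lambda>w. 1 - busy k w)" using adapted_R[of k] by (simp add: adapted_def)
    moreover have "(\<integral>w. (1 - busy k w) * (if 0 < R k w then g w else 0) \<partial>P) = 0" for g
      by (subst Bochner_Integration.integral_cong[OF refl, of _ _ "\<lambda>_. 0"]) auto
    ultimately show ?thesis by (auto simp: past_def memoryless_def intro!: exI[of _ 1])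
  qed
  from past_lincomb[OF past_const'[of 1] this, of 1 "-1"] show ?thesis by (simp cong: if_cong)
qed

text \<open>Each earlier \<open>Y j\<close> is itself a test function for step \<open>k\<close>, so
  \<open>orth\<close> yields pairwise orthogonality, as for martingale differences.\<close>

lemma strong_law_past:
  assumes Y: "\<And>k. Y k \<in> past (Suc k)" and C: "\<And>k w. \<bar>Y k w\<bar> \<le> C"
    and orth: "\<And>k Z. Z \<in> past k \<Longrightarrow> (\<integral>w. Z w * Y k w \<partial>P) = 0"
  shows "AE w in P. (\<lambda>n. (\<Sum>k<n. Y k w) / real n) \<longlonglongrightarrow> 0"
proof (rule P.strong_law_orthogonal)
  show m: "Y k \<in> borel_measurable P" for k using Y by (rule pastD)
  have sq: "\<bar>(Y k w)\<^sup>2\<bar> \<le> C\<^sup>2" for k w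
    using C[of k w] by (simp add: abs_le_square_iff power2_le_iff_abs_le order_trans[OF abs_ge_zero])
  show "integrable P (\<lambda>w. (Y k w)\<^sup>2)" for k
    using m sq by (intro integrable_bounded_P) auto
  show "P.expectation (\<lambda>w. (Y k w)\<^sup>2) \<le> C\<^sup>2" for k
    using P.abs_expectation_le[of "\<lambda>w. (Y k w)\<^sup>2" "C\<^sup>2"] sq m by simp
  show "P.expectation (\<lambda>w. Y j w * Y k w) = 0" if "j < k" for j k
    using that by (intro orth past_mono[OF Y]) simp
  show "AE w in P. \<forall>k. - C \<le> Y k w" using C by (auto simp: abs_le_iff minus_le_iff)
qed

section \<open>Transition and success probabilities of the busy chain\<close>

text \<open>Probability of busy after idle: a service time outlasts an interarrival time.\<close>

definition busy_idle :: real where "busy_idle = lam / (lam + mu)"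
text \<open>Probability of busy after busy: either the residual outlasts the interarrival time (the
  summand 1), or the buffered packet starts in time and its own service is still running at the next
  arrival.\<close>

definition busy_busy :: real where
  "busy_busy = lam / (lam + mu) * (1 + mu / (lam + mu) * (1 - exp (- (lam + mu) * (d - \<theta>))))"
text \<open>Probability of \<open>r \<le> a\<close>, \<open>r \<le> d - \<theta>\<close> and
  \<open>r + s \<le> d\<close> for independent exponential \<open>r\<close>, \<open>s\<close> of
  rate \<open>mu\<close> and \<open>a\<close> of rate \<open>lam\<close>: the success of a packet
  that finds the server busy.\<close>

definition ok_busy :: real where
  "ok_busy = mu / (lam + mu) * (1 - exp (- (lam + mu) * (d - \<theta>))) - mu * exp (- mu * d) / lam * (1 - exp (- lam * (d - \<theta>)))"

lemma integral_past_busy: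
  assumes Z: "Z \<in> past k"
  shows "(\<integral>w. Z w * busy (Suc k) w \<partial>P)
    = busy_idle * (\<integral>w. Z w * (1 - busy k w) \<partial>P) + busy_busy * (\<integral>w. Z w * busy k w \<partial>P)"
proof -
  \<comment> \<open>The event \<open>r \<le> a\<close> has probability
    \<open>exp (- lam * r)\<close>; given it, the excess \<open>a - r\<close> is again exponential,
    and the new service must outlast it.\<close>
  have inner: "(\<integral>a. (if r \<le> a \<and> r \<le> d - \<theta> then exp (- mu * (a - r)) else 0) \<partial>exp_measure lam)
      = lam / (lam + mu) * (if r \<le> d - \<theta> then exp (- lam * r) else 0)" if "0 \<le> r" for r
  proof (cases "r \<le> d - \<theta>")
    case True
    then show ?thesis
      using integral_exp_measure_shift[OF lam that, of "\<lambda>x. exp (- mu * x)"]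
        integral_exp_measure_exp[OF lam, of mu] lam mu by simp
  qed simp
  have "(\<integral>r. \<integral>a. (if r \<le> a \<and> r \<le> d - \<theta> then exp (- mu * (a - r)) else 0) \<partial>exp_measure lam \<partial>exp_measure mu)
      = (\<integral>r. lam / (lam + mu) * (if r \<le> d - \<theta> then exp (- lam * r) else 0) \<partial>exp_measure mu)"
    by (intro integral_cong_AE eventually_mono[OF AE_exp_measure_nonneg] inner) measurable
  also have "\<dots> = lam / (lam + mu) * (mu / (lam + mu) * (1 - exp (- (lam + mu) * (d - \<theta>))))"
    using integral_exp_measure_atMost_tilt[OF mu, of lam "d - \<theta>"] lam mu \<theta> by (simp add: add.commute)
  finally have K: "(\<integral>r. \<integral>a. (if r \<le> a \<and> r \<le> d - \<theta> then exp (- mu * (a - r)) else 0) \<partial>exp_measure lam \<partial>exp_measure mu)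
      = lam / (lam + mu) * (mu / (lam + mu) * (1 - exp (- (lam + mu) * (d - \<theta>))))" .
  have E: "(\<integral>a. exp (- mu * a) \<partial>exp_measure lam) = lam / (lam + mu)"
    using lam mu by (intro integral_exp_measure_exp) auto
  have one: "(\<integral>x. 1 \<partial>exp_measure mu) = (1::real)" using Emu.prob_space by simp
  have "(\<integral>w. Z w * 1 * busy (Suc k) w \<partial>P) = (\<integral>x. 1 \<partial>exp_measure mu) *
      ((\<integral>a. 1 * exp (- mu * a) \<partial>exp_measure lam) * (\<integral>w. Z w * (1 - busy k w) \<partial>P)
       + ((\<integral>r. \<integral>a. (if r \<le> a \<and> r \<le> d - \<theta> then 1 * exp (- mu * (a - r)) else 0)
             \<partial>exp_measure lam \<partial>exp_measure mu) + 1 * (\<integral>a. exp (- mu * a) \<partial>exp_measure lam))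
          * (\<integral>w. Z w * busy k w \<partial>P))"
    by (rule integral_past_step[OF Z, of "\<lambda>_. 1" 1 "\<lambda>_ _. 1" 1 1]) simp_all
  then have "(\<integral>w. Z w * busy (Suc k) w \<partial>P) = lam / (lam + mu) * (\<integral>w. Z w * (1 - busy k w) \<partial>P)
      + (lam / (lam + mu) * (mu / (lam + mu) * (1 - exp (- (lam + mu) * (d - \<theta>)))) + lam / (lam + mu))
          * (\<integral>w. Z w * busy k w \<partial>P)"
    unfolding mult_1_left mult_1_right one K E .
  moreover have "lam / (lam + mu) * (mu / (lam + mu) * (1 - exp (- (lam + mu) * (d - \<theta>)))) + lam / (lam + mu)
      = busy_busy"
    unfolding busy_busy_def by (simp only: distrib_left mult_1_right add.commute)
  ultimately show ?thesis unfolding busy_idle_def by simp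
qed

text \<open>Conditional success probability of a packet that finds residual time
  \<open>r > 0\<close>, given \<open>r\<close> and the next interarrival time. It vanishes for
  \<open>r \<le> 0\<close> and for \<open>a < r\<close>, which fits the conditions of
  \<open>past_step\<close>; packets finding an idle server are counted separately.\<close>

definition ok_given :: "real \<Rightarrow> real \<Rightarrow> real" where
  "ok_given r a = (if 0 < r \<and> r \<le> a \<and> r \<le> d - \<theta> then 1 - exp (- mu * (d - r)) else 0)"

lemma ok_given_bound: "\<bar>ok_given r a\<bar> \<le> 1"
  using mu \<theta> by (auto simp: ok_given_def)

lemma measurable_ok_given: "(\<lambda>(r, a). ok_given r a) \<in> borel_measurable (borel \<Otimes>\<^sub>M borel)"
  unfolding ok_given_def by measurable

lemma integral_past_ok_given:
  assumes Z: "Z \<in> past k"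
  shows "(\<integral>w. Z w * ok_given (R k w) (w (Inl (Suc k))) \<partial>P) = ok_busy * (\<integral>w. Z w * busy k w \<partial>P)"
proof -
  have one: "(\<integral>s. c \<partial>exp_measure mu) = (c::real)" for c using Emu.prob_space by simp
  let ?D = "d - \<theta>"
  have "(\<integral>w. Z w * ok_given (R k w) (w (Inl (Suc k))) \<partial>P)
    = 0 * (\<integral>w. Z w * (1 - busy k w) \<partial>P) + ok_busy * (\<integral>w. Z w * busy k w \<partial>P)"
  proof (rule integral_given_past[OF Z, of "\<lambda>r a _. ok_given r a" 1])
    show "(\<lambda>(r, a, s). ok_given r a) \<in> borel_measurable (borel \<Otimes>\<^sub>M borel \<Otimes>\<^sub>M (borel :: real measure))"
      unfolding ok_given_def by measurable
    show "(\<integral>a. \<integral>s. ok_given r a \<partial>exp_measure mu \<partial>exp_measure lam) = 0" if "r \<le> 0" for r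
      using that by (simp add: ok_given_def)
    \<comment> \<open>The product of \<open>1 - exp (- mu * (d - r))\<close> and
      \<open>exp (- lam * r)\<close> is split into two exponentials. The coefficient
      \<open>lam - mu\<close> may have either sign, but the tilted rate
      \<open>mu + (lam - mu)\<close> is \<open>lam\<close>.\<close>
    have inner: "(\<integral>a. ok_given r a \<partial>exp_measure lam)
        = (if r \<le> ?D then exp (- lam * r) else 0) - exp (- mu * d) * (if r \<le> ?D then exp (- (lam - mu) * r) else 0)"
      if r: "0 < r" for r
    proof -
      have "(\<integral>a. ok_given r a \<partial>exp_measure lam)
          = (\<integral>a. (if r \<le> ?D then 1 - exp (- mu * (d - r)) else 0) * (if r \<le> a then 1 else 0) \<partial>exp_measure lam)"
        using r by (intro Bochner_Integration.integral_cong) (auto simp: ok_given_def)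
      also have "\<dots> = (if r \<le> ?D then 1 - exp (- mu * (d - r)) else 0) * exp (- lam * r)"
        using integral_exp_measure_shift[OF lam, of r "\<lambda>_. 1"] r Elam.prob_space by simp
      finally show ?thesis by (simp add: algebra_simps exp_add[symmetric] flip: exp_diff)
    qed
    have int: "integrable (exp_measure mu) (\<lambda>r. if r \<le> ?D then exp (- c * r) else 0)" for c
    proof (rule Emu.integrable_const_bound[of _ "exp (\<bar>c\<bar> * ?D)"])
      have "- c * r \<le> \<bar>c\<bar> * ?D" if "0 \<le> r" "r \<le> ?D" for r
        using that by (intro mult_mono) auto
      then show "AE r in exp_measure mu. norm (if r \<le> ?D then exp (- c * r) else 0) \<le> exp (\<bar>c\<bar> * ?D)"
        using AE_exp_measure_nonneg[of mu] by (auto elim!: eventually_mono)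
    qed measurable
    have "(\<integral>r. \<integral>a. \<integral>s. ok_given r a \<partial>exp_measure mu \<partial>exp_measure lam \<partial>exp_measure mu)
        = (\<integral>r. (if r \<le> ?D then exp (- lam * r) else 0) - exp (- mu * d) * (if r \<le> ?D then exp (- (lam - mu) * r) else 0) \<partial>exp_measure mu)"
      unfolding one
    proof (rule integral_cong_AE)
      show "AE r in exp_measure mu. (\<integral>a. ok_given r a \<partial>exp_measure lam)
          = (if r \<le> ?D then exp (- lam * r) else 0) - exp (- mu * d) * (if r \<le> ?D then exp (- (lam - mu) * r) else 0)"
        using AE_exp_measure_nonneg[of mu] AE_exp_measure_neq[of 0 mu] by eventually_elim (rule inner, simp)
      show "(\<lambda>r. \<integral>a. ok_given r a \<partial>exp_measure lam) \<in> borel_measurable (exp_measure mu)"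
        unfolding ok_given_def by measurable
    qed measurable
    also have "\<dots> = (\<integral>r. (if r \<le> ?D then exp (- lam * r) else 0) \<partial>exp_measure mu)
        - exp (- mu * d) * (\<integral>r. (if r \<le> ?D then exp (- (lam - mu) * r) else 0) \<partial>exp_measure mu)"
      using int by simp
    also have "\<dots> = ok_busy"
      using integral_exp_measure_atMost_tilt[OF mu, of lam ?D] integral_exp_measure_atMost_tilt[OF mu, of "lam - mu" ?D] lam mu \<theta>
      by (simp add: ok_busy_def add.commute)
    finally show "(\<integral>r. \<integral>a. \<integral>s. ok_given r a \<partial>exp_measure mu \<partial>exp_measure lam \<partial>exp_measure mu) = ok_busy" .
  qed (rule ok_given_bound)
  then show ?thesis by simp
qed

lemma integrable_past_mult:
  assumes Z: "Z \<in> past k" and Y: "Y \<in> borel_measurable P" and b: "\<And>w. \<bar>Y w\<bar> \<le> C"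
  shows "integrable P (\<lambda>w. Z w * Y w)"
proof -
  obtain B where B: "\<And>w. \<bar>Z w\<bar> \<le> B" using pastD(2)[OF Z] by blast
  have "\<bar>Z w * Y w\<bar> \<le> B * C" for w
    unfolding abs_mult using B b by (intro mult_mono) (auto intro: order_trans[OF abs_ge_zero])
  with pastD(1)[OF Z] Y show ?thesis by (intro integrable_bounded_P) simp_all
qed

section \<open>Strong laws along the sample path\<close>

text \<open>The deviation of \<open>busy (Suc k)\<close> from its transition probability is
  orthogonal to the past, so its averages vanish and the averaged recursion yields the stationary
  value.\<close>

lemma strong_law_busy:
  assumes ne: "busy_busy - busy_idle \<noteq> 1"
  shows "AE w in P. (\<lambda>n. (\<Sum>k<n. busy k w) / real n) \<longlonglongrightarrow> busy_idle / (1 - (busy_busy - busy_idle))"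
proof -
  let ?\<beta> = "busy_busy - busy_idle"
  let ?Y = "\<lambda>k w. busy (Suc k) w - (busy_idle + ?\<beta> * busy k w)"
  have "AE w in P. (\<lambda>n. (\<Sum>k<n. ?Y k w) / real n) \<longlonglongrightarrow> 0"
  proof (rule strong_law_past)
    fix k
    have "(\<lambda>w. 1 * busy (Suc k) w + (-1) * (busy_idle * 1 + ?\<beta> * busy k w)) \<in> past (Suc k)"
      by (intro past_lincomb past_const' past_mono[OF past_busy]) simp_all
    moreover have "(\<lambda>w. 1 * busy (Suc k) w + (-1) * (busy_idle * 1 + ?\<beta> * busy k w)) = ?Y k"
      by (simp only: mult_1_left mult_1_right mult_minus_left add_uminus_conv_diff)
    ultimately show "?Y k \<in> past (Suc k)" by (simp only:)
    show "\<bar>?Y k w\<bar> \<le> 1 + (\<bar>busy_idle\<bar> + \<bar>?\<beta>\<bar>)" for w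
      by (intro order_trans[OF abs_triangle_ineq4] add_mono order_trans[OF abs_triangle_ineq]) simp_all
    fix Z assume Z: "Z \<in> past k"
    have eq: "Z w * ?Y k w = Z w * busy (Suc k) w - busy_idle * (Z w * (1 - busy k w)) - busy_busy * (Z w * busy k w)" for w
      by (cases "0 < R k w"; cases "0 < R (Suc k) w") (simp_all add: algebra_simps)
    have int: "integrable P (\<lambda>w. Z w * busy (Suc k) w)" "integrable P (\<lambda>w. Z w * (1 - busy k w))"
        "integrable P (\<lambda>w. Z w * busy k w)"
      by (intro integrable_past_mult[OF Z, of _ 1]; simp)+
    have lin: "(\<integral>w. f w - a * g w - b * h w \<partial>P) = (\<integral>w. f w \<partial>P) - a * (\<integral>w. g w \<partial>P) - b * (\<integral>w. h w \<partial>P)"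
      if "integrable P f" "integrable P g" "integrable P h" for f g h and a b :: real
      using that by simp
    have "(\<integral>w. Z w * ?Y k w \<partial>P) = (\<integral>w. Z w * busy (Suc k) w \<partial>P)
        - busy_idle * (\<integral>w. Z w * (1 - busy k w) \<partial>P) - busy_busy * (\<integral>w. Z w * busy k w \<partial>P)"
      unfolding eq by (rule lin[OF int])
    then show "(\<integral>w. Z w * ?Y k w \<partial>P) = 0"
      unfolding integral_past_busy[OF Z] by simp
  qed
  then show ?thesis
  proof eventually_elim
    case (elim w)
    show ?case by (rule tendsto_average_of_recursion[OF _ ne elim]) simp
  qed
qed

text \<open>\<open>ok_given\<close> uses only \<open>R k\<close> and the next interarrival time, so
  it belongs to the past at the next arrival; its conditional mean is \<open>ok_busy\<close> times
  the busy indicator.\<close>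

lemma strong_law_ok_given:
  "AE w in P. (\<lambda>n. (\<Sum>k<n. ok_given (R k w) (w (Inl (Suc k))) - ok_busy * busy k w) / real n) \<longlonglongrightarrow> 0"
proof (rule strong_law_past)
  fix k
  have "(\<lambda>w. 1 * ok_given (R k w) (w (Inl (Suc k)))) \<in> past (Suc k)"
    by (rule past_step[OF past_const' measurable_ok_given ok_given_bound, of 0]) (auto simp: ok_given_def)
  then have ok: "(\<lambda>w. ok_given (R k w) (w (Inl (Suc k)))) \<in> past (Suc k)"
    by (simp only: mult_1_left)
  have "(\<lambda>w. 1 * ok_given (R k w) (w (Inl (Suc k))) + (- ok_busy) * busy k w) \<in> past (Suc k)"
    by (intro past_lincomb ok past_mono[OF past_busy]) simp_all
  then show "(\<lambda>w. ok_given (R k w) (w (Inl (Suc k))) - ok_busy * busy k w) \<in> past (Suc k)"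
    by (simp only: mult_1_left mult_minus_left add_uminus_conv_diff)
  show "\<bar>ok_given (R k w) (w (Inl (Suc k))) - ok_busy * busy k w\<bar> \<le> 1 + \<bar>ok_busy\<bar>" for w
    by (rule order_trans[OF abs_triangle_ineq4], rule add_mono[OF ok_given_bound]) simp
  fix Z assume Z: "Z \<in> past k"
  have int: "integrable P (\<lambda>w. Z w * ok_given (R k w) (w (Inl (Suc k))))"
    by (rule integrable_past_mult[OF Z pastD(1)[OF ok] ok_given_bound])
  have int2: "integrable P (\<lambda>w. Z w * busy k w)"
    by (intro integrable_past_mult[OF Z, of _ 1]; simp)
  have eq: "Z w * (ok_given (R k w) (w (Inl (Suc k))) - ok_busy * busy k w)
      = Z w * ok_given (R k w) (w (Inl (Suc k))) - ok_busy * (Z w * busy k w)" for w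
    by (simp only: right_diff_distrib mult.left_commute)
  have "(\<integral>w. Z w * (ok_given (R k w) (w (Inl (Suc k))) - ok_busy * busy k w) \<partial>P)
      = (\<integral>w. Z w * ok_given (R k w) (w (Inl (Suc k))) \<partial>P) - ok_busy * (\<integral>w. Z w * busy k w \<partial>P)"
    unfolding eq using int int2
    by (simp only: Bochner_Integration.integral_diff integrable_mult_right integral_mult_right_zero simp_thms)
  then show "(\<integral>w. Z w * (ok_given (R k w) (w (Inl (Suc k))) - ok_busy * busy k w) \<partial>P) = 0"
    unfolding integral_past_ok_given[OF Z] by simp
qed

text \<open>Fluctuation of the success indicator around its conditional probability given everything but
  the packet's own service time \<^term>\<open>s\<close>.\<close>

definition ok_noise :: "real \<Rightarrow> real \<Rightarrow> real \<Rightarrow> real" where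
  "ok_noise r a s =
    (if r \<le> 0 then (if s \<le> d then 1 else 0) - (1 - exp (- mu * d))
     else if r \<le> a \<and> r \<le> d - \<theta> then (if s \<le> d - r then 1 else 0) - (1 - exp (- mu * (d - r))) else 0)"

lemma integral_ok_noise: "(\<integral>s. ok_noise r a s \<partial>exp_measure mu) = 0"
proof -
  have *: "(\<integral>s. (if s \<le> c then 1 else 0) - (1 - exp (- mu * c)) \<partial>exp_measure mu) = 0" if "0 \<le> c" for c
  proof -
    have "integrable (exp_measure mu) (\<lambda>s. if s \<le> c then 1 else 0 :: real)"
      by (rule Emu.integrable_const_bound[of _ 1]) simp_all
    then show ?thesis
      using integral_exp_measure_atMost[OF mu that] Emu.prob_space by simp
  qed
  consider "r \<le> 0" | "0 < r" "r \<le> a" "r \<le> d - \<theta>" | "0 < r" "\<not> (r \<le> a \<and> r \<le> d - \<theta>)" by linarith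
  then show ?thesis
  proof cases
    case 1
    then show ?thesis unfolding ok_noise_def using *[of d] d by simp
  next
    case 2
    then show ?thesis unfolding ok_noise_def using *[of "d - r"] \<theta> by simp
  next
    case 3
    then have "ok_noise r a = (\<lambda>s. 0)" by (auto simp: ok_noise_def)
    then show ?thesis by simp
  qed
qed

lemma ok_noise_bound: "\<bar>ok_noise r a s\<bar> \<le> 1"
proof -
  have *: "\<bar>(if Q then 1 else 0) - (1 - exp (- mu * c))\<bar> \<le> 1" if "0 \<le> c" for c Q
    using mu that by simp
  show ?thesis unfolding ok_noise_def using *[of d "s \<le> d"] *[of "d - r" "s \<le> d - r"] d \<theta> by simp
qed

text \<open>The service of packet \<open>k\<close> may still be running at the next arrival, so
  these terms need not lie in \<open>past (Suc k)\<close>. Orthogonality comes instead from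
  redrawing the service time of the later packet, on which the earlier term does not depend.\<close>

lemma strong_law_ok_noise:
  "AE w in P. (\<lambda>n. (\<Sum>k<n. ok_noise (R k w) (w (Inl (Suc k))) (w (Inr k))) / real n) \<longlonglongrightarrow> 0"
proof (rule P.strong_law_orthogonal)
  let ?Y = "\<lambda>k w. ok_noise (R k w) (w (Inl (Suc k))) (w (Inr k))"
  have "(\<lambda>(r, a, s). ok_noise r a s) \<in> borel_measurable (borel \<Otimes>\<^sub>M borel \<Otimes>\<^sub>M borel)"
    unfolding ok_noise_def by measurable
  then show m: "?Y k \<in> borel_measurable P" for k
    by (rule measurable_compose3) (rule measurable_resid measurable_coord)+
  have sq: "\<bar>(?Y k w)\<^sup>2\<bar> \<le> 1" for k w
    using ok_noise_bound[of "R k w" "w (Inl (Suc k))" "w (Inr k)"] by (simp add: abs_square_le_1)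
  show "integrable P (\<lambda>w. (?Y k w)\<^sup>2)" for k
    by (rule integrable_bounded_P[OF borel_measurable_power[OF m] sq])
  show "P.expectation (\<lambda>w. (?Y k w)\<^sup>2) \<le> 1" for k
    using P.abs_expectation_le[OF borel_measurable_power[OF m] sq, of k] by (rule abs_le_D1)
  show "AE w in P. \<forall>k. - 1 \<le> ?Y k w"
    using ok_noise_bound by (auto simp: abs_le_iff minus_le_iff)
  show "P.expectation (\<lambda>w. ?Y j w * ?Y k w) = 0" if "j < k" for j k
  proof -
    have "\<bar>?Y j w * ?Y k w\<bar> \<le> 1 * 1" for w
      unfolding abs_mult by (intro mult_mono ok_noise_bound) simp_all
    then have "integrable P (\<lambda>w. ?Y j w * ?Y k w)"
      by (rule integrable_bounded_P[OF borel_measurable_times[OF m m]])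
    then have "(\<integral>w. ?Y j w * ?Y k w \<partial>P)
        = (\<integral>w. \<integral>s. ?Y j (w(Inr k := s)) * ?Y k (w(Inr k := s)) \<partial>law (Inr k) \<partial>P)"
      by (rule integral_resample)
    also have "\<dots> = (\<integral>w. \<integral>s. ?Y j w * ok_noise (R k w) (w (Inl (Suc k))) s \<partial>exp_measure mu \<partial>P)"
      using adapted_R[of j] adapted_R[of k] that by (simp add: adapted_def)
    also have "\<dots> = 0"
      unfolding integral_mult_right_zero integral_ok_noise by simp
    finally show ?thesis .
  qed
qed

lemma strong_law_interarrival:
  "AE w in P. (\<lambda>n. (\<Sum>k<n. w (Inl k) - 1 / lam) / real n) \<longlonglongrightarrow> 0"
proof (rule P.strong_law_orthogonal)
  note [measurable] = measurable_coord
  have D: "distributed P lborel (\<lambda>w. w (Inl k)) (exponential_density lam)" for k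
  proof -
    have "distr P lborel (\<lambda>w. w (Inl k)) = distr P (law (Inl k)) (\<lambda>w. w (Inl k))"
      by (rule distr_cong) simp_all
    also have "\<dots> = exp_measure lam"
      unfolding P_def by (subst distr_PiM_component) (simp_all add: prob_space_law)
    finally show ?thesis
      unfolding distributed_def exp_measure_def by simp
  qed
  show "(\<lambda>w. w (Inl k) - 1 / lam) \<in> borel_measurable P" for k by measurable
  have i2: "integrable P (\<lambda>w. (w (Inl k))\<^sup>2)" and i1: "integrable P (\<lambda>w. w (Inl k))" for k
    using P.erlang_ith_moment_integrable[OF lam D, of k 2] P.erlang_ith_moment_integrable[OF lam D, of k 1] by simp_all
  show sq: "integrable P (\<lambda>w. (w (Inl k) - 1 / lam)\<^sup>2)" for k
    unfolding power2_diff using i1 i2 by simp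
  show "P.expectation (\<lambda>w. (w (Inl k) - 1 / lam)\<^sup>2) \<le> 1 / lam\<^sup>2" for k
    using P.exponential_distributed_variance[OF lam D, of k] P.exponential_distributed_expectation[OF lam D, of k] by simp
  show "AE w in P. \<forall>k. - (1 / lam) \<le> w (Inl k) - 1 / lam"
    using AE_coord_nonneg by eventually_elim simp
  show "P.expectation (\<lambda>w. (w (Inl j) - 1 / lam) * (w (Inl k) - 1 / lam)) = 0" if "j < k" for j k
  proof -
    have zero: "(\<integral>a. a - 1 / lam \<partial>exp_measure lam) = 0"
      using Elam.exponential_distributed_expectation[OF lam distributed_exp_measure] Elam.prob_space
        Elam.erlang_ith_moment_integrable[OF lam distributed_exp_measure, of 1] by simp
    have "integrable P (\<lambda>w. (w (Inl j) - 1 / lam) * (w (Inl k) - 1 / lam))"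
      by (intro integrable_mult_of_squares sq) measurable
    then have "(\<integral>w. (w (Inl j) - 1 / lam) * (w (Inl k) - 1 / lam) \<partial>P)
        = (\<integral>w. \<integral>a. ((w(Inl k := a)) (Inl j) - 1 / lam) * ((w(Inl k := a)) (Inl k) - 1 / lam) \<partial>law (Inl k) \<partial>P)"
      by (rule integral_resample)
    also have "\<dots> = (\<integral>w. \<integral>a. (w (Inl j) - 1 / lam) * (a - 1 / lam) \<partial>exp_measure lam \<partial>P)"
      using that by simp
    also have "\<dots> = 0" unfolding integral_mult_right_zero zero by simp
    finally show ?thesis .
  qed
qed

text \<open>The quotient is the stationary busy probability of the two-state chain; its denominator
  equals \<open>N / (lam + mu)\<^sup>2\<close>, which is positive.\<close>

lemma busy_limit:
  defines "N \<equiv> mu\<^sup>2 + lam * mu * exp (- (lam + mu) * (d - \<theta>)) + lam\<^sup>2 + lam * mu"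
  shows "busy_busy - busy_idle \<noteq> 1"
    and "busy_idle / (1 - (busy_busy - busy_idle)) = (lam\<^sup>2 + lam * mu) / N"
proof -
  define e where "e = exp (- (lam + mu) * (d - \<theta>))"
  have N: "N = mu\<^sup>2 + lam * mu * e + lam\<^sup>2 + lam * mu" unfolding N_def e_def ..
  have "0 < e" by (simp add: e_def)
  then have Npos: "0 < N" unfolding N using lam mu by (intro add_pos_pos mult_pos_pos) simp_all
  have s: "0 < lam + mu" using lam mu by simp
  have bb: "busy_busy = lam / (lam + mu) * (1 + mu / (lam + mu) * (1 - e))"
    unfolding busy_busy_def e_def ..
  have eq: "1 - (busy_busy - busy_idle) = N / (lam + mu)\<^sup>2"
    unfolding bb busy_idle_def N using s by (simp add: power2_eq_square divide_simps) (simp add: algebra_simps)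
  show "busy_busy - busy_idle \<noteq> 1"
    using eq Npos s by auto
  show "busy_idle / (1 - (busy_busy - busy_idle)) = (lam\<^sup>2 + lam * mu) / N"
    unfolding eq unfolding busy_idle_def using s Npos by (simp add: power2_eq_square divide_simps) (simp add: algebra_simps)
qed

section \<open>Goodput on the canonical space\<close>

lemma card_eq_sum: "real (card {k. k < n \<and> Q k}) = (\<Sum>k<n. if Q k then 1 else 0)" for n :: nat
  by (simp flip: sum.inter_filter)

lemma goodput_canonical:
  defines "p0 \<equiv> 1 - (lam\<^sup>2 + lam * mu) /
                   (mu\<^sup>2 + lam * mu * exp (- (lam + mu) * (d - \<theta>)) + lam\<^sup>2 + lam * mu)"
  shows "AE w in P.
     ((\<lambda>n. real (card {k. k < n \<and> finds_empty d \<theta> (\<lambda>i. w (Inl i)) (\<lambda>i. w (Inr i)) k}) / real n) \<longlonglongrightarrow> p0)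
     \<and> ((\<lambda>t. real (goodput_count d \<theta> (\<lambda>i. w (Inl i)) (\<lambda>i. w (Inr i)) t) / t)
          \<longlongrightarrow> lam * (p0 * (1 - exp (- mu * d)) + (1 - p0) * ok_busy)) at_top"
  using strong_law_busy[OF busy_limit(1)] strong_law_ok_given strong_law_ok_noise
    strong_law_interarrival AE_coord_nonneg
proof eventually_elim
  case (elim w)
  let ?A = "\<lambda>i. w (Inl i)" and ?S = "\<lambda>i. w (Inr i)"
  let ?ok = "served_ok d \<theta> ?A ?S"
  let ?F = "1 - exp (- mu * d)"
  have busy: "(\<lambda>n. (\<Sum>k<n. busy k w) / real n) \<longlonglongrightarrow> 1 - p0"
    using elim(1) unfolding busy_limit(2) p0_def by simp
  have nz: "\<forall>\<^sub>F n in sequentially. 0 < n" by (rule eventually_gt_at_top)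
  have "(\<lambda>n. 1 - (\<Sum>k<n. busy k w) / real n) \<longlonglongrightarrow> 1 - (1 - p0)"
    by (intro tendsto_intros busy)
  then have idle: "(\<lambda>n. (\<Sum>k<n. 1 - busy k w) / real n) \<longlonglongrightarrow> p0"
    unfolding diff_diff_eq2 add_diff_cancel_left'
  proof (rule Lim_transform_eventually)
    show "\<forall>\<^sub>F n in sequentially. 1 - (\<Sum>k<n. busy k w) / real n = (\<Sum>k<n. 1 - busy k w) / real n"
      using nz
    proof eventually_elim
      case (elim n)
      then show ?case unfolding sum_subtractf diff_divide_distrib by simp
    qed
  qed
  have empty: "real (card {k. k < n \<and> finds_empty d \<theta> ?A ?S k}) = (\<Sum>k<n. 1 - busy k w)" for n
    unfolding card_eq_sum by (intro sum.cong) (auto simp: finds_empty_iff)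
  let ?noise = "\<lambda>k. ok_noise (R k w) (w (Inl (Suc k))) (w (Inr k))"
  let ?given = "\<lambda>k. ok_given (R k w) (w (Inl (Suc k))) - ok_busy * busy k w"
  \<comment> \<open>The first two terms average to zero by the strong laws; the others leave the
    success probabilities weighted by the long-run busy and idle fractions.\<close>
  have okk: "(if ?ok k then 1 else 0) = ?noise k + ?given k + ok_busy * busy k w + ?F * (1 - busy k w)" for k
    by (auto simp: served_ok_iff ok_noise_def ok_given_def algebra_simps)
  have "(\<lambda>n. (\<Sum>k<n. ?noise k) / real n + (\<Sum>k<n. ?given k) / real n
      + ok_busy * ((\<Sum>k<n. busy k w) / real n) + ?F * ((\<Sum>k<n. 1 - busy k w) / real n))
      \<longlonglongrightarrow> 0 + 0 + ok_busy * (1 - p0) + ?F * p0"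
    by (intro tendsto_add tendsto_mult tendsto_const elim busy idle)
  also have "(\<lambda>n. (\<Sum>k<n. ?noise k) / real n + (\<Sum>k<n. ?given k) / real n
      + ok_busy * ((\<Sum>k<n. busy k w) / real n) + ?F * ((\<Sum>k<n. 1 - busy k w) / real n))
      = (\<lambda>n. real (card {k. k < n \<and> ?ok k}) / real n)"
    unfolding card_eq_sum okk sum.distrib sum_distrib_left[symmetric] add_divide_distrib times_divide_eq_right ..
  finally have dens: "(\<lambda>n. real (card {k. k < n \<and> ?ok k}) / real n) \<longlonglongrightarrow> p0 * ?F + (1 - p0) * ok_busy"
    by (simp only: add_0_left mult.commute add.commute)
  have "(\<lambda>n. (\<Sum>k<n. w (Inl k) - 1 / lam) / real n + 1 / lam) \<longlonglongrightarrow> 0 + 1 / lam"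
    by (intro tendsto_add tendsto_const elim)
  then have "(\<lambda>n. (\<Sum>k<n. w (Inl k)) / real n) \<longlonglongrightarrow> 1 / lam"
    unfolding add_0_left
    by (rule Lim_transform_eventually)
       (rule eventually_mono[OF nz], simp add: sum_subtractf diff_divide_distrib)
  \<comment> \<open>\<open>arr_time\<close> at index \<open>k\<close> sums \<open>k + 1\<close>
    interarrival times, hence the index shift.\<close>
  then have "(\<lambda>n. (\<Sum>k<Suc n. w (Inl k)) / real (Suc n) * (real (Suc n) / real n)) \<longlonglongrightarrow> 1 / lam * 1"
    by (intro tendsto_mult LIMSEQ_Suc_n_over_n LIMSEQ_Suc)
  then have rate: "(\<lambda>k. arr_time ?A k / real k) \<longlonglongrightarrow> 1 / lam"
    unfolding mult_1_right arr_time_def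
    by (rule Lim_transform_eventually)
       (rule eventually_mono[OF nz], simp add: lessThan_Suc_atMost del: of_nat_Suc sum.lessThan_Suc)
  have mono: "mono (arr_time ?A)"
    unfolding arr_time_def using elim by (intro monoI sum_mono2) auto
  have c: "arr_time ?A k \<le> completion_time d \<theta> ?A ?S k \<and> completion_time d \<theta> ?A ?S k \<le> arr_time ?A k + d"
    if "?ok k" for k
    using completion_time_bounds[OF that] elim(5) by simp
  have "((\<lambda>x. real (card {k. ?ok k \<and> completion_time d \<theta> ?A ?S k \<le> x}) / x)
      \<longlongrightarrow> lam * (p0 * ?F + (1 - p0) * ok_busy)) at_top"
    by (rule rate_of_delayed_count[OF lam mono rate dens c])
  with idle show ?case unfolding empty goodput_count_def by blast
qed

end

section \<open>Transfer to an arbitrary probability space\<close>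

lemma distr_eq_exp_measure:
  assumes "distributed M lborel X (\<lambda>x. ennreal (exponential_density l x))"
  shows "distr M borel X = exp_measure l"
proof -
  have "distr M borel X = distr M lborel X" by (rule distr_cong) simp_all
  then show ?thesis using assms by (simp add: distributed_def exp_measure_def)
qed

theorem theorem1:
  fixes M :: "'w measure" and A S :: "nat \<Rightarrow> 'w \<Rightarrow> real"
    and lam mu d \<theta> :: real
  assumes "prob_space M"
    and "lam > 0" and "mu > 0" and "d > 0" and "0 \<le> \<theta>" and "\<theta> \<le> d"
    and "\<And>k. distributed M lborel (A k) (\<lambda>x. ennreal (exponential_density lam x))"
    and "\<And>k. distributed M lborel (S k) (\<lambda>x. ennreal (exponential_density mu x))"
    and "prob_space.indep_vars M (\<lambda>_. borel)
           (\<lambda>i. case i of Inl k \<Rightarrow> A k | Inr k \<Rightarrow> S k) UNIV"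
  shows "let p0 = 1 - (lam\<^sup>2 + lam * mu) /
                   (mu\<^sup>2 + lam * mu * exp (- (lam + mu) * (d - \<theta>)) + lam\<^sup>2 + lam * mu);
             gp = lam * p0 * (1 - exp (- mu * d))
                 + lam * (1 - p0) * (mu / (lam + mu) * (1 - exp (- (lam + mu) * (d - \<theta>)))
                                   - mu * exp (- mu * d) / lam * (1 - exp (- lam * (d - \<theta>))))
         in AE \<omega> in M.
              ((\<lambda>n. real (card {k. k < n \<and> finds_empty d \<theta> (\<lambda>i. A i \<omega>) (\<lambda>i. S i \<omega>) k}) / real n)
                 \<longlonglongrightarrow> p0)
            \<and> ((\<lambda>t. real (goodput_count d \<theta> (\<lambda>i. A i \<omega>) (\<lambda>i. S i \<omega>) t) / t)
                 \<longlongrightarrow> gp) at_top"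
proof -
  interpret M: prob_space M by fact
  interpret packet_skipping lam mu d \<theta> using assms by unfold_locales
  let ?X = "\<lambda>i. case i of Inl k \<Rightarrow> A k | Inr k \<Rightarrow> S k"
  have X: "?X i \<in> borel_measurable M" for i
    using assms(7,8)[THEN distributed_measurable] by (cases i) simp_all
  \<comment> \<open>Independence and the exponential marginals make \<open>P\<close> the joint law
    of all clocks, so almost sure statements under \<open>P\<close> pull back to
    \<open>M\<close>.\<close>
  have "distr M (Pi\<^sub>M UNIV (\<lambda>_. borel)) (\<lambda>x. \<lambda>i\<in>UNIV. ?X i x) = Pi\<^sub>M UNIV (\<lambda>i. distr M borel (?X i))"
    using M.indep_vars_iff_distr_eq_PiM[of UNIV ?X "\<lambda>_. borel", OF _ X] assms(9) by blast
  also have "\<dots> = P"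
    unfolding P_def
    by (intro PiM_cong refl) (simp add: law_def distr_eq_exp_measure[OF assms(7)] distr_eq_exp_measure[OF assms(8)] split: sum.split)
  finally have distr: "distr M (Pi\<^sub>M UNIV (\<lambda>_. borel)) (\<lambda>x. \<lambda>i\<in>UNIV. ?X i x) = P" .
  have "(\<lambda>x. \<lambda>i\<in>UNIV. ?X i x) \<in> measurable M (Pi\<^sub>M UNIV (\<lambda>_. borel))"
    using X by (intro measurable_restrict)
  from AE_distrD[OF this, unfolded distr, OF goodput_canonical]
  show ?thesis
    by (simp only: Let_def ok_busy_def distrib_left mult.assoc restrict_apply UNIV_I if_True sum.case)
qed

end
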